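(* Let $p,q\in[1,\infty]$, let $\psi$ and $p$ satisfy the integrability condition (I) given in the context, and let $\boldsymbol\gamma=(\gamma_{\mathfrak u})_{\mathfrak u\subseteq[1:d]}$ be a family of non-negative weights, not all zero. Then $W_{\pitchfork,p,q,\psi,\boldsymbol\gamma}=W_{A,p,q,\psi,\boldsymbol\gamma}$ (as vector spaces of functions on $D^d$) if and only if the following holds for every $\mathfrak w\subseteq[1:d]$: $$\gamma_{\mathfrak w}>0\quad\text{implies that}\quad\gamma_{\mathfrak u}>0\text{ for all }\mathfrak u\subseteq\mathfrak w.$$ Moreover, if this condition does not hold, then $W_{\pitchfork,p,q,\psi,\boldsymbol\gamma}\not\subseteq W_{A,p,q,\psi,\boldsymbol\gamma}$ and $W_{A,p,q,\psi,\boldsymbol\gamma}\not\subseteq W_{\pitchfork,p,q,\psi,\boldsymbol\gamma}$.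
   Context: Setting. $D$ is an interval, either $D=[0,T)$ with $T\in(0,\infty]$ or $D=[0,T]$ with $T\in(0,\infty)$; $\psi:D\to[0,\infty)$ is a probability density function (with respect to Lebesgue measure) that is positive almost everywhere. $d$ is a positive integer, $[1:d]=\{1,\dots,d\}$, and $\mathfrak u,\mathfrak w$ denote subsets of $[1:d]$. For $\mathfrak u\neq\emptyset$, $D^{\mathfrak u}$ is the set of points $\boldsymbol x_{\mathfrak u}=(x_j)_{j\in\mathfrak u}$ with $x_j\in D$; functions on $D^{\mathfrak u}$ are identified with functions on $D^d$ depending only on the variables with indices in $\mathfrak u$. For $1\le p\le\infty$, $p'$ is the conjugate index, $1/p+1/p'=1$. $L_{p,\psi}(D^{\mathfrak u})$ is the Banach space of (classes of) real-valued functions with norm $\|g\|_{L_{p,\psi}(D^{\mathfrak u})}=\left(\int_{D^{\mathfrak u}}|g(\boldsymbol t_{\mathfrak u})|^p\prod_{j\in\mathfrak u}\psi(t_j)\,d\boldsymbol t_{\mathfrak u}\right)^{1/p}$ for $p<\infty$ and the essential supremum norm for $p=\infty$. $L_p^{\mathrm{loc}}(D)$ is the set of functions on $D$ whose restriction to $[0,x)$ is in $L_p([0,x))$ for all $x\in D$. Put $\overline\psi(t)=\int_t^T\psi(y)\,dy$. Integrability condition (I) for $p$ and $\psi$: either $p=\infty$ and $\overline\psi\in L_1(D)$; or $p<\infty$, $\psi^{-1/p}\in L_{p'}^{\mathrm{loc}}(D)$ and $\overline\psi\cdot\psi^{-1/p}\in L_{p'}(D)$. Kernels: $K_\pitchfork(x,t)=1_{[0,x)}(t)$,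 $K_A(x,t)=1_{[0,x)}(t)-\overline\psi(t)$ for $x,t\in D$, and $K_{\star,\mathfrak u}(\boldsymbol x_{\mathfrak u},\boldsymbol t_{\mathfrak u})=\prod_{j\in\mathfrak u}K_\star(x_j,t_j)$ for $\star\in\{\pitchfork,A\}$. For $\mathfrak u\ne\emptyset$ and $g_{\mathfrak u}\in L_{p,\psi}(D^{\mathfrak u})$ put $T_{\star,\mathfrak u}(g_{\mathfrak u})=\int_{D^{\mathfrak u}}g_{\mathfrak u}(\boldsymbol t_{\mathfrak u})K_{\star,\mathfrak u}(\cdot_{\mathfrak u},\boldsymbol t_{\mathfrak u})\,d\boldsymbol t_{\mathfrak u}$. For $\mathfrak u=\emptyset$, $L_{p,\psi}(D^\emptyset)=\mathbb R$ and $T_{\star,\emptyset}(c)$ is the constant function $c$. Let $F_{\star,p,\psi,\mathfrak u}=T_{\star,\mathfrak u}(L_{p,\psi}(D^{\mathfrak u}))$. The sum of the spaces $F_{\star,p,\psi,\mathfrak u}$ over $\mathfrak u\subseteq[1:d]$ (inside the continuous functions on $D^d$) is direct. For weights $\boldsymbol\gamma$ let $\mathfrak U_{\boldsymbol\gamma}=\{\mathfrak u\subseteq[1:d]:\gamma_{\mathfrak u}>0\}$. As a vector space of functions on $D^d$, $W_{\star,p,q,\psi,\boldsymbol\gamma}=\bigoplus_{\mathfrak u\in\mathfrak U_{\boldsymbol\gamma}}F_{\star,p,\psi,\mathfrak u}$, i.e. the set of functions $\sum_{\mathfrak u\in\mathfrak U_{\boldsymbol\gamma}}T_{\star,\mathfrak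 u}(g_{\mathfrak u})$ with $g_{\mathfrak u}\in L_{p,\psi}(D^{\mathfrak u})$. ($\star=\pitchfork$: anchored space; $\star=A$: ANOVA space. The index $q$ only enters the norm, which is not needed here.) *)

theory Defs
  imports "HOL-Probability.Probability"
begin

text \<open>
  Points of \<open>D\<^sup>\<uu>\<close> are extensional functions in \<open>\<Pi>\<^sub>E j\<in>\<uu>. D\<close>, carrying the product of the
  Lebesgue measures on \<open>D\<close>. The product sigma-algebra is not complete, but every class of almost
  everywhere equal Lebesgue measurable functions has a representative measurable for it.
\<close>

definition admissible_interval :: "ereal \<Rightarrow> real set \<Rightarrow> bool" where
  "admissible_interval T D \<longleftrightarrow>
     0 < T \<and> (D = {x. 0 \<le> x \<and> ereal x < T} \<or> T < \<infinity> \<and> D = {x. 0 \<le> x \<and> ereal x \<le> T})"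

definition positive_density :: "real set \<Rightarrow> (real \<Rightarrow> real) \<Rightarrow> bool" where
  "positive_density D \<psi> \<longleftrightarrow>
     \<psi> \<in> borel_measurable (lebesgue_on D) \<and> (\<forall>t\<in>D. 0 \<le> \<psi> t) \<and>
     (\<integral>\<^sup>+ t. ennreal (\<psi> t) \<partial>lebesgue_on D) = 1 \<and>
     (AE t in lebesgue_on D. 0 < \<psi> t)"

definition tail :: "real set \<Rightarrow> (real \<Rightarrow> real) \<Rightarrow> real \<Rightarrow> real" where
  "tail D \<psi> t = (\<integral>y. \<psi> y \<partial>lebesgue_on (D \<inter> {t..}))"

text \<open>
  Representatives of the elements of the weighted \<open>L\<^sub>p\<close> space on \<open>M\<close>. The weight \<open>w\<close> enters only
  for finite \<open>p\<close>; the essential supremum is taken with respect to \<open>M\<close> itself.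
\<close>

definition weighted_Lp :: "ennreal \<Rightarrow> 'a measure \<Rightarrow> ('a \<Rightarrow> real) \<Rightarrow> ('a \<Rightarrow> real) set" where
  "weighted_Lp p M w = {g \<in> borel_measurable M.
     if p = \<infinity> then esssup M (\<lambda>x. ereal \<bar>g x\<bar>) < \<infinity>
     else (\<integral>\<^sup>+ x. ennreal (\<bar>g x\<bar> powr enn2real p * w x) \<partial>M) < \<infinity>}"

abbreviation Lp :: "ennreal \<Rightarrow> 'a measure \<Rightarrow> ('a \<Rightarrow> real) set" where
  "Lp p M \<equiv> weighted_Lp p M (\<lambda>_. 1)"

definition Lp_loc :: "ennreal \<Rightarrow> real set \<Rightarrow> (real \<Rightarrow> real) set" where
  "Lp_loc p D = {g. \<forall>x\<in>D. g \<in> Lp p (lebesgue_on {0..<x})}"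

text \<open>
  The conjugate index is taken in \<^typ>\<open>ennreal\<close>, where \<open>1 / 0 = \<infinity>\<close> and \<open>1 / \<infinity> = 0\<close>. Where \<open>\<psi>\<close>
  vanishes, which is a null set, \<open>\<psi> powr (- 1 / p)\<close> has the value \<open>0\<close>.
\<close>

definition integrability_condition :: "real set \<Rightarrow> ennreal \<Rightarrow> (real \<Rightarrow> real) \<Rightarrow> bool" where
  "integrability_condition D p \<psi> \<longleftrightarrow>
     (p = \<infinity> \<and> tail D \<psi> \<in> Lp 1 (lebesgue_on D)) \<or>
     (p < \<infinity> \<and>
      (\<exists>p'::ennreal. 1 / p + 1 / p' = 1 \<and>
         (\<lambda>t. \<psi> t powr (- 1 / enn2real p)) \<in> Lp_loc p' D \<and>
         (\<lambda>t. tail D \<psi> t * \<psi> t powr (- 1 / enn2real p)) \<in> Lp p' (lebesgue_on D)))"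

definition K_anchored :: "real \<Rightarrow> real \<Rightarrow> real" where
  "K_anchored x t = indicator {0..<x} t"

definition K_ANOVA :: "real set \<Rightarrow> (real \<Rightarrow> real) \<Rightarrow> real \<Rightarrow> real \<Rightarrow> real" where
  "K_ANOVA D \<psi> x t = indicator {0..<x} t - tail D \<psi> t"

abbreviation leb_pow :: "nat set \<Rightarrow> real set \<Rightarrow> (nat \<Rightarrow> real) measure" where
  "leb_pow u D \<equiv> (\<Pi>\<^sub>M j\<in>u. lebesgue_on D)"

definition Lp_psi :: "real set \<Rightarrow> ennreal \<Rightarrow> (real \<Rightarrow> real) \<Rightarrow> nat set \<Rightarrow> ((nat \<Rightarrow> real) \<Rightarrow> real) set" where
  "Lp_psi D p \<psi> u = weighted_Lp p (leb_pow u D) (\<lambda>t. \<Prod>j\<in>u. \<psi> (t j))"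

text \<open>
  The value at \<open>x \<in> D\<^sup>d\<close> depends only on the coordinates of \<open>x\<close> with index in \<open>u\<close>. The case
  \<open>u = {}\<close> needs no separate clause, because the empty product is the unit point mass at
  \<open>\<lambda>_. undefined\<close>; the two lemmas below show that it has the intended meaning.
\<close>

definition T_op :: "(real \<Rightarrow> real \<Rightarrow> real) \<Rightarrow> real set \<Rightarrow> nat set \<Rightarrow> ((nat \<Rightarrow> real) \<Rightarrow> real)
    \<Rightarrow> (nat \<Rightarrow> real) \<Rightarrow> real" where
  "T_op K D u g x = (\<integral>t. g t * (\<Prod>j\<in>u. K (x j) (t j)) \<partial>leb_pow u D)"

lemma T_op_empty: "T_op K D {} g x = g (\<lambda>_. undefined)"
  by (simp add: T_op_def PiM_empty lebesgue_integral_count_space_finite)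

lemma Lp_psi_empty: "Lp_psi D p \<psi> {} = UNIV"
proof -
  have "esssup (count_space {\<lambda>_. undefined}) (\<lambda>x. ereal \<bar>g x\<bar>) < \<infinity>"
    for g :: "(nat \<Rightarrow> real) \<Rightarrow> real"
  proof -
    have "esssup (count_space {\<lambda>_. undefined}) (\<lambda>x. ereal \<bar>g x\<bar>) \<le> ereal \<bar>g (\<lambda>_. undefined)\<bar>"
      by (intro esssup_I) (auto simp: AE_count_space)
    also have "\<dots> < \<infinity>" by simp
    finally show ?thesis .
  qed
  then show ?thesis
    by (auto simp: Lp_psi_def weighted_Lp_def PiM_empty nn_integral_count_space_finite)
qed

abbreviation cube :: "nat \<Rightarrow> real set \<Rightarrow> (nat \<Rightarrow> real) set" where
  "cube d D \<equiv> {1..d} \<rightarrow>\<^sub>E D"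

text \<open>Functions on \<open>D\<^sup>d\<close> are extensional, so that equality means equality on \<open>D\<^sup>d\<close>.\<close>

definition F_space :: "(real \<Rightarrow> real \<Rightarrow> real) \<Rightarrow> nat \<Rightarrow> real set \<Rightarrow> ennreal \<Rightarrow> (real \<Rightarrow> real) \<Rightarrow> nat set
    \<Rightarrow> ((nat \<Rightarrow> real) \<Rightarrow> real) set" where
  "F_space K d D p \<psi> u = (\<lambda>g. restrict (T_op K D u g) (cube d D)) ` Lp_psi D p \<psi> u"

definition active :: "nat \<Rightarrow> (nat set \<Rightarrow> real) \<Rightarrow> nat set set" where
  "active d \<gamma> = {u. u \<subseteq> {1..d} \<and> \<gamma> u > 0}"

text \<open>
  The vector space underlying the weighted space with kernel \<open>K\<close>. The index \<open>q\<close> only enters the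
  norm and is therefore not used on the right-hand side.
\<close>

definition W_space :: "(real \<Rightarrow> real \<Rightarrow> real) \<Rightarrow> nat \<Rightarrow> real set \<Rightarrow> ennreal \<Rightarrow> ennreal \<Rightarrow> (real \<Rightarrow> real)
    \<Rightarrow> (nat set \<Rightarrow> real) \<Rightarrow> ((nat \<Rightarrow> real) \<Rightarrow> real) set" where
  "W_space K d D p q \<psi> \<gamma> =
     {(\<lambda>x\<in>cube d D. \<Sum>u\<in>active d \<gamma>. f u x) | f. \<forall>u\<in>active d \<gamma>. f u \<in> F_space K d D p \<psi> u}"

definition downward_closed_weights :: "nat \<Rightarrow> (nat set \<Rightarrow> real) \<Rightarrow> bool" where
  "downward_closed_weights d \<gamma> \<longleftrightarrow>
     (\<forall>w. w \<subseteq> {1..d} \<longrightarrow> \<gamma> w > 0 \<longrightarrow> (\<forall>u. u \<subseteq> w \<longrightarrow> \<gamma> u > 0))"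

end

theory Submission
  imports Defs
begin

text \<open>
  Both kernels have the form \<open>1\<^bsub>[0,x)\<^esub>(t) - c(t)\<close> with \<open>c(t) = \<mu>{x. t < x}\<close> for a probability measure
  \<open>\<mu>\<close> on \<open>D\<close>: the point mass at \<open>0\<close> gives the anchored kernel, the measure with density \<open>\<psi>\<close> the
  ANOVA kernel. For two such functions \<open>c\<close> and \<open>c'\<close>, multiplying out
  \<open>\<Prod>j\<in>u. ((1\<^bsub>[0,x j)\<^esub>(t j) - c'(t j)) + (c'(t j) - c(t j)))\<close> writes \<open>T\<^sub>c g\<close> as a sum over \<open>v \<subseteq> u\<close> of
  functions \<open>T\<^sub>c\<^sub>' g\<^sub>v\<close>, where \<open>g\<^sub>v\<close> is a partial integral of \<open>g\<close>, which is in the weighted \<open>L\<^sub>p\<close> space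
  by Hoelder's inequality. This gives equality for downward closed weights.

  Conversely, let \<open>w\<close> be active and \<open>u \<subseteq> w\<close> inactive. Integrate a function on \<open>D\<^sup>d\<close> against
  \<open>\<delta>\<^sub>a - \<delta>\<^sub>0\<close> in the coordinates from \<open>u\<close> and against \<open>\<mu>\<close> in the others. Since the kernel given by
  \<open>\<mu>\<close> has \<open>\<mu>\<close>-mean zero in \<open>x\<close>, this functional annihilates the whole space for that kernel, whereas
  on the image of the constant function \<open>1\<close> on \<open>D\<^sup>w\<close> under the operator for the other kernel it is,
  up to sign and normalisation, a product of powers of \<open>a\<close> and of the integral of \<open>tail D \<psi>\<close>, which is nonzero.
\<close>

section \<open>Weighted Lp spaces and Hoelder's inequality\<close>

text \<open>Arithmetic in \<open>ennreal\<close> becomes real arithmetic only for finite values, so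
  infinite exponents are split off. Both exponents are at least 1 because each reciprocal is bounded
  by the sum 1.\<close>

lemma conjugate_exponents_cases:
  fixes p q :: ennreal
  assumes "1 / p + 1 / q = 1"
  obtains "p = 1" "q = \<infinity>" | "p = \<infinity>" "q = 1"
    | a b where "p = ennreal a" "q = ennreal b" "1 < a" "1 < b" "1 / a + 1 / b = 1"
proof -
  have inv: "1 / x \<le> 1 \<Longrightarrow> 1 \<le> x" for x :: ennreal
  proof (cases x)
    case (real r)
    assume *: "1 / x \<le> 1"
    have "r \<noteq> 0" using * real by (auto simp: ennreal_divide_zero top_unique)
    then have "ennreal (1 / r) \<le> 1" using * real
      by (metis divide_ennreal ennreal_1 less_eq_real_def zero_le_one)
    with real \<open>r \<noteq> 0\<close> show ?thesis by (simp add: divide_le_eq)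
  qed auto
  have "1 / p \<le> 1 / p + 1 / q" "1 / q \<le> 1 / p + 1 / q" by auto
  then have p: "1 \<le> p" and q: "1 \<le> q"
    unfolding assms by (auto intro: inv)
  show thesis
  proof (cases p)
    case top
    then have "1 / q = 1" using assms by simp
    then have "q = 1"
      by (metis divide_eq_1_ennreal ennreal_divide_top zero_neq_one)
    with top that show ?thesis by simp
  next
    case (real a)
    note a = this
    show ?thesis
    proof (cases q)
      case top
      then have "1 / p = 1" using assms by simp
      then have "p = 1"
        by (metis divide_eq_1_ennreal ennreal_divide_top zero_neq_one)
      with top that show ?thesis by simp
    next
      case (real b)
      have ab: "1 \<le> a" "1 \<le> b" using p q a real by auto
      have "1 / p + 1 / q = ennreal (1 / a + 1 / b)"
        using ab a real by (simp add: divide_ennreal flip: ennreal_1)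
      with assms ab have eq: "1 / a + 1 / b = 1"
        by (metis ennreal_1 ennreal_inj add_nonneg_nonneg divide_nonneg_nonneg order_trans zero_le_one)
      \<comment> \<open>Finite exponents have positive reciprocals, so neither reciprocal uses up
        the whole sum 1; this excludes the exponent 1.\<close>
      have "0 < 1 / a" "0 < 1 / b" using ab by auto
      with eq have "1 / a < 1" "1 / b < 1" by linarith+
      then have "a \<noteq> 1" "b \<noteq> 1" by auto
      with ab have "1 < a" "1 < b" by simp_all
      with a real eq that show ?thesis by blast
    qed
  qed
qed

text \<open>The essential supremum is itself an almost everywhere bound, so its finiteness amounts
  to the existence of a real bound.\<close>

lemma weighted_Lp_infinity_iff:
  "g \<in> weighted_Lp \<top> M w \<longleftrightarrow> g \<in> borel_measurable M \<and> (\<exists>C. AE x in M. \<bar>g x\<bar> \<le> C)"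
proof safe
  assume g: "g \<in> weighted_Lp \<top> M w"
  then show "g \<in> borel_measurable M" by (simp add: weighted_Lp_def)
  from g have lt: "esssup M (\<lambda>x. ereal \<bar>g x\<bar>) < \<infinity>" by (simp add: weighted_Lp_def)
  then obtain C where C: "esssup M (\<lambda>x. ereal \<bar>g x\<bar>) \<le> ereal C"
    by (cases "esssup M (\<lambda>x. ereal \<bar>g x\<bar>)") auto
  have "AE x in M. \<bar>g x\<bar> \<le> C"
    using esssup_AE[of "\<lambda>x. ereal \<bar>g x\<bar>" M]
  proof eventually_elim
    case (elim x)
    then have "ereal \<bar>g x\<bar> \<le> ereal C" using C by order
    then show ?case by simp
  qed
  then show "\<exists>C. AE x in M. \<bar>g x\<bar> \<le> C" by blast
next
  fix C assume g: "g \<in> borel_measurable M" and C: "AE x in M. \<bar>g x\<bar> \<le> C"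
  have "esssup M (\<lambda>x. ereal \<bar>g x\<bar>) \<le> ereal C"
    using g C by (intro esssup_I) auto
  also have "\<dots> < \<infinity>" by simp
  finally show "g \<in> weighted_Lp \<top> M w" using g by (simp add: weighted_Lp_def)
qed

lemma weighted_Lp_finite_iff:
  "p < \<infinity> \<Longrightarrow> g \<in> weighted_Lp p M w \<longleftrightarrow> g \<in> borel_measurable M \<and>
     (\<integral>\<^sup>+ x. ennreal (\<bar>g x\<bar> powr enn2real p * w x) \<partial>M) < \<infinity>"
  by (auto simp: weighted_Lp_def)

lemma weighted_Lp_measurable: "g \<in> weighted_Lp p M w \<Longrightarrow> g \<in> borel_measurable M"
  by (simp add: weighted_Lp_def)

lemma weighted_Lp_add:
  assumes f: "f \<in> weighted_Lp p M w" and g: "g \<in> weighted_Lp p M w"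
    and w[measurable]: "w \<in> borel_measurable M"
  shows "(\<lambda>x. f x + g x) \<in> weighted_Lp p M w"
proof (cases "p = \<infinity>")
  case True
  obtain A B where A: "AE x in M. \<bar>f x\<bar> \<le> A" and B: "AE x in M. \<bar>g x\<bar> \<le> B"
    using f g True by (auto simp: weighted_Lp_infinity_iff)
  have "AE x in M. \<bar>f x + g x\<bar> \<le> A + B" using A B by eventually_elim auto
  moreover have "(\<lambda>x. f x + g x) \<in> borel_measurable M"
    using f[THEN weighted_Lp_measurable] g[THEN weighted_Lp_measurable] by simp
  ultimately show ?thesis using True by (auto simp: weighted_Lp_infinity_iff)
next
  case False
  then have p: "p < \<infinity>" by (simp add: less_top)
  let ?r = "enn2real p"
  note [measurable] = weighted_Lp_measurable[OF f] weighted_Lp_measurable[OF g]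
  \<comment> \<open>Bounding the sum by twice the maximum costs a factor 2^r but uses only
    monotonicity of powers. Where \<open>w x\<close> is negative, \<open>ennreal\<close> truncates
    all terms to 0.\<close>
  have bd: "ennreal (\<bar>f x + g x\<bar> powr ?r * w x)
      \<le> ennreal (2 powr ?r) * (ennreal (\<bar>f x\<bar> powr ?r * w x) + ennreal (\<bar>g x\<bar> powr ?r * w x))" for x
  proof (cases "0 \<le> w x")
    case True
    have "\<bar>f x + g x\<bar> powr ?r \<le> (2 * max \<bar>f x\<bar> \<bar>g x\<bar>) powr ?r"
      by (rule powr_mono2) auto
    also have "\<dots> = 2 powr ?r * max \<bar>f x\<bar> \<bar>g x\<bar> powr ?r" by (simp add: powr_mult)
    also have "\<dots> \<le> 2 powr ?r * (\<bar>f x\<bar> powr ?r + \<bar>g x\<bar> powr ?r)"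
      by (intro mult_left_mono) (auto simp: max_def)
    finally have "\<bar>f x + g x\<bar> powr ?r * w x \<le> 2 powr ?r * (\<bar>f x\<bar> powr ?r * w x + \<bar>g x\<bar> powr ?r * w x)"
      using True by (smt (verit, best) mult.assoc distrib_right mult_right_mono)
    then show ?thesis using True
      by (simp add: ennreal_leI flip: ennreal_plus ennreal_mult)
  qed (auto simp: ennreal_neg mult_nonneg_nonpos)
  have "(\<integral>\<^sup>+ x. ennreal (\<bar>f x + g x\<bar> powr ?r * w x) \<partial>M)
      \<le> (\<integral>\<^sup>+ x. ennreal (2 powr ?r) * (ennreal (\<bar>f x\<bar> powr ?r * w x) + ennreal (\<bar>g x\<bar> powr ?r * w x)) \<partial>M)"
    by (intro nn_integral_mono bd)
  also have "\<dots> = ennreal (2 powr ?r) * ((\<integral>\<^sup>+ x. ennreal (\<bar>f x\<bar> powr ?r * w x) \<partial>M)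
      + (\<integral>\<^sup>+ x. ennreal (\<bar>g x\<bar> powr ?r * w x) \<partial>M))"
    by (subst nn_integral_cmult) (auto simp: nn_integral_add)
  also have "\<dots> < \<infinity>"
    using f g p by (auto simp: weighted_Lp_finite_iff ennreal_mult_less_top)
  finally show ?thesis using p by (auto simp: weighted_Lp_finite_iff)
qed

lemma weighted_Lp_dominated:
  assumes f: "f \<in> weighted_Lp p M w" and g: "g \<in> borel_measurable M"
    and w: "AE x in M. 0 \<le> w x" and le: "AE x in M. \<bar>g x\<bar> \<le> \<bar>f x\<bar>"
  shows "g \<in> weighted_Lp p M w"
proof (cases "p = \<infinity>")
  case True
  obtain A where A: "AE x in M. \<bar>f x\<bar> \<le> A"
    using f True by (auto simp: weighted_Lp_infinity_iff)
  have "AE x in M. \<bar>g x\<bar> \<le> A" using A le by eventually_elim auto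
  with True g show ?thesis by (auto simp: weighted_Lp_infinity_iff)
next
  case False
  then have p: "p < \<infinity>" by (simp add: less_top)
  have "(\<integral>\<^sup>+ x. ennreal (\<bar>g x\<bar> powr enn2real p * w x) \<partial>M) \<le> (\<integral>\<^sup>+ x. ennreal (\<bar>f x\<bar> powr enn2real p * w x) \<partial>M)"
    by (rule nn_integral_mono_AE, use le w in eventually_elim)
      (auto intro!: ennreal_leI mult_right_mono powr_mono2)
  with f g p show ?thesis by (auto simp: weighted_Lp_finite_iff)
qed

text \<open>For \<open>p = \<infinity>\<close> the exponent is \<open>- 1 / 0 = 0\<close>, so that the weight only matters where it vanishes.\<close>

definition dual_weighted :: "ennreal \<Rightarrow> ennreal \<Rightarrow> 'a measure \<Rightarrow> ('a \<Rightarrow> real) \<Rightarrow> ('a \<Rightarrow> real) set" where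
  "dual_weighted p q M w =
     {b \<in> borel_measurable M. (\<lambda>t. b t * w t powr (- 1 / enn2real p)) \<in> Lp q M}"

lemma dual_weighted_measurable: "b \<in> dual_weighted p q M w \<Longrightarrow> b \<in> borel_measurable M"
  by (simp add: dual_weighted_def)

lemma dual_weighted_dominated:
  assumes "f \<in> dual_weighted p q M w" and [measurable]: "g \<in> borel_measurable M" "w \<in> borel_measurable M"
    and le: "AE x in M. \<bar>g x\<bar> \<le> \<bar>f x\<bar>"
  shows "g \<in> dual_weighted p q M w"
proof -
  have "(\<lambda>t. g t * w t powr (- 1 / enn2real p)) \<in> Lp q M"
  proof (rule weighted_Lp_dominated[where f="\<lambda>t. f t * w t powr (- 1 / enn2real p)"])
  show "AE x in M. \<bar>g x * w x powr (- 1 / enn2real p)\<bar> \<le> \<bar>f x * w x powr (- 1 / enn2real p)\<bar>"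
    using le by eventually_elim (auto simp: abs_mult mult_right_mono)
  qed (use assms in \<open>auto simp: dual_weighted_def\<close>)
  then show ?thesis by (simp add: dual_weighted_def)
qed

lemma dual_weighted_add:
  assumes "f \<in> dual_weighted p q M w" "g \<in> dual_weighted p q M w" 
  shows "(\<lambda>x. f x + g x) \<in> dual_weighted p q M w"
proof -
  have "(\<lambda>x. f x * w x powr (- 1 / enn2real p) + g x * w x powr (- 1 / enn2real p)) \<in> Lp q M"
    using assms by (intro weighted_Lp_add) (auto simp: dual_weighted_def)
  with assms show ?thesis by (auto simp: dual_weighted_def algebra_simps)
qed

text \<open>A non-integrable function has Bochner integral 0 by default, so the bound covers it as
  well.\<close>

lemma norm_integral_le_nn_integral:
  fixes f :: "'a \<Rightarrow> real"
  shows "ennreal \<bar>\<integral>x. f x \<partial>M\<bar> \<le> (\<integral>\<^sup>+ x. ennreal \<bar>f x\<bar> \<partial>M)"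
  using integral_norm_bound_ennreal[of M f] by (cases "integrable M f") (auto simp: not_integrable_integral_eq)

text \<open>Hoelder's inequality for the factorisation g b = (g w^(1/p)) (b w^(-1/p)). The constant
  depends on b but not on g and is not sharp; \<open>nn_integral\<close> on the left makes
  integrability of the product a consequence.\<close>

lemma Holder_bound_ex:
  fixes M :: "'a measure"
  assumes pq: "1 / p + 1 / q = 1" and p: "p < \<infinity>"
    and w[measurable]: "w \<in> borel_measurable M" and pos: "AE x in M. 0 < w x"
    and b: "b \<in> dual_weighted p q M w"
  shows "\<exists>C\<ge>1. \<forall>g\<in>borel_measurable M.
      (\<integral>\<^sup>+ x. ennreal (\<bar>g x\<bar> powr enn2real p * w x) \<partial>M) < \<infinity> \<longrightarrow>
      (\<integral>\<^sup>+ x. ennreal \<bar>g x * b x\<bar> \<partial>M)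
        \<le> ennreal (C * enn2real (\<integral>\<^sup>+ x. ennreal (\<bar>g x\<bar> powr enn2real p * w x) \<partial>M) powr (1 / enn2real p))"
  using pq
proof (cases rule: conjugate_exponents_cases)
  case 1
  note [measurable] = dual_weighted_measurable[OF b]
  obtain C0 where C0: "AE x in M. \<bar>b x * w x powr (- 1)\<bar> \<le> C0"
    using b 1 unfolding dual_weighted_def by (auto simp: weighted_Lp_infinity_iff)
  define C where "C = max 1 C0"
  \<comment> \<open>For p = 1 the dual condition says that b / w is essentially bounded, so b is
    dominated by a multiple of the weight.\<close>
  have C: "AE x in M. \<bar>b x\<bar> \<le> C * w x"
    using C0 pos
  proof eventually_elim
    case (elim x)
    then have "\<bar>b x\<bar> / w x \<le> C0" by (simp add: powr_minus abs_mult divide_inverse)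
    also have "\<dots> \<le> C" by (simp add: C_def)
    finally show ?case using elim by (simp add: divide_le_eq)
  qed
  show ?thesis
  proof (intro exI[of _ C] conjI ballI impI)
    show "1 \<le> C" by (simp add: C_def)
    fix g :: "'a \<Rightarrow> real" assume [measurable]: "g \<in> borel_measurable M"
    assume fin: "(\<integral>\<^sup>+ x. ennreal (\<bar>g x\<bar> powr enn2real p * w x) \<partial>M) < \<infinity>"
    then have fin': "(\<integral>\<^sup>+ x. ennreal (\<bar>g x\<bar> * w x) \<partial>M) < \<infinity>" using 1 by simp
    have "(\<integral>\<^sup>+ x. ennreal \<bar>g x * b x\<bar> \<partial>M) \<le> (\<integral>\<^sup>+ x. ennreal C * ennreal (\<bar>g x\<bar> * w x) \<partial>M)"
    proof (rule nn_integral_mono_AE, use C pos in eventually_elim)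
      fix x assume *: "\<bar>b x\<bar> \<le> C * w x" "0 < w x"
      have "\<bar>g x * b x\<bar> \<le> C * (\<bar>g x\<bar> * w x)"
        using mult_left_mono[OF *(1), of "\<bar>g x\<bar>"] by (simp add: abs_mult mult_ac)
      then show "ennreal \<bar>g x * b x\<bar> \<le> ennreal C * ennreal (\<bar>g x\<bar> * w x)"
        using * by (simp add: C_def flip: ennreal_mult)
    qed
    also have "\<dots> = ennreal C * (\<integral>\<^sup>+ x. ennreal (\<bar>g x\<bar> * w x) \<partial>M)"
      by (rule nn_integral_cmult) measurable
    also have "\<dots> = ennreal (C * enn2real (\<integral>\<^sup>+ x. ennreal (\<bar>g x\<bar> * w x) \<partial>M))"
      using fin' by (simp add: C_def ennreal_mult)
    finally show "(\<integral>\<^sup>+ x. ennreal \<bar>g x * b x\<bar> \<partial>M)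
        \<le> ennreal (C * enn2real (\<integral>\<^sup>+ x. ennreal (\<bar>g x\<bar> powr enn2real p * w x) \<partial>M) powr (1 / enn2real p))"
      using 1 by simp
  qed
next
  case 2
  with p show ?thesis by simp
next
  case (3 r s)
  note [measurable] = dual_weighted_measurable[OF b]
  have rs: "enn2real p = r" "enn2real q = s" using 3 by auto
  have split: "ennreal (u * v + u' * v') = ennreal u * ennreal v + ennreal u' * ennreal v'"
    if "0 \<le> u" "0 \<le> v" "0 \<le> u'" "0 \<le> v'" for u v u' v' :: real
    using that by (simp add: ennreal_mult)
  define h where "h x = b x * w x powr (- 1 / r)" for x
  have [measurable]: "h \<in> borel_measurable M" unfolding h_def by measurable
  define B where "B = enn2real (\<integral>\<^sup>+ x. ennreal (\<bar>h x\<bar> powr s) \<partial>M)"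
  have B: "(\<integral>\<^sup>+ x. ennreal (\<bar>h x\<bar> powr s) \<partial>M) = ennreal B"
    using b 3 rs unfolding dual_weighted_def B_def h_def by (auto simp: weighted_Lp_finite_iff)
  have "0 \<le> B" by (simp add: B_def)
  \<comment> \<open>The number 1 / r + B / s is what Young's inequality yields after the rescaling
    by l below.\<close>
  define C where "C = max 1 (1 / r + B / s)"
  show ?thesis
    unfolding rs
  proof (intro exI[of _ C] conjI ballI impI)
    show "1 \<le> C" by (simp add: C_def)
    fix g :: "'a \<Rightarrow> real" assume [measurable]: "g \<in> borel_measurable M"
    define A where "A = enn2real (\<integral>\<^sup>+ x. ennreal (\<bar>g x\<bar> powr r * w x) \<partial>M)"
    assume fin: "(\<integral>\<^sup>+ x. ennreal (\<bar>g x\<bar> powr r * w x) \<partial>M) < \<infinity>"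
    then have A: "(\<integral>\<^sup>+ x. ennreal (\<bar>g x\<bar> powr r * w x) \<partial>M) = ennreal A"
      by (simp add: A_def)
    have "0 \<le> A" by (simp add: A_def)
    have "(\<integral>\<^sup>+ x. ennreal \<bar>g x * b x\<bar> \<partial>M) \<le> ennreal (C * A powr (1 / r))"
    proof (cases "A = 0")
      \<comment> \<open>If the weighted integral of g is 0, then g vanishes almost everywhere
        because the weight is positive. The rescaling in the other case needs A > 0.\<close>
      case True
      then have "(\<integral>\<^sup>+ x. ennreal (\<bar>g x\<bar> powr r * w x) \<partial>M) = 0" using A by simp
      then have "AE x in M. ennreal (\<bar>g x\<bar> powr r * w x) = 0"
        by (subst (asm) nn_integral_0_iff_AE) auto
      then have "AE x in M. ennreal \<bar>g x * b x\<bar> = 0" using pos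
        by eventually_elim (auto simp: ennreal_eq_0_iff mult_le_0_iff)
      then have "(\<integral>\<^sup>+ x. ennreal \<bar>g x * b x\<bar> \<partial>M) = 0"
        by (subst nn_integral_0_iff_AE) auto
      then show ?thesis by simp
    next
      case False
      with \<open>0 \<le> A\<close> have "A > 0" by simp
      \<comment> \<open>Young's inequality is applied to l times one factor and 1 / l times the
        other. This l makes both l^r A and (1 / l)^s equal to A^(1/r), the weighted L_p norm of g,
        so that both terms scale like that norm.\<close>
      define l where "l = A powr (- 1 / (r * s))"
      have l: "l > 0" using \<open>A > 0\<close> by (simp add: l_def)
      have rs1: "1 / s = 1 - 1 / r" using 3 by (simp add: algebra_simps)
      have e1: "l powr r * A = A powr (1 / r)"
      proof -
        have "l powr r * A = A powr (- 1 / s) * A powr 1"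
          using 3 \<open>A > 0\<close> by (simp add: l_def powr_powr)
        also have "\<dots> = A powr (1 / r)" 
          using rs1 by (simp only: flip: powr_add) simp
        finally show ?thesis .
      qed
      have e2: "(1 / l) powr s = A powr (1 / r)"
      proof -
        have "1 / l = A powr (1 / (r * s))" by (simp add: l_def powr_minus_divide)
        then show ?thesis using 3 by (simp add: powr_powr)
      qed
      have "(\<integral>\<^sup>+ x. ennreal \<bar>g x * b x\<bar> \<partial>M)
          \<le> (\<integral>\<^sup>+ x. ennreal (l powr r / r) * ennreal (\<bar>g x\<bar> powr r * w x)
                + ennreal ((1 / l) powr s / s) * ennreal (\<bar>h x\<bar> powr s) \<partial>M)"
      proof (rule nn_integral_mono_AE, use pos in eventually_elim)
        fix x assume w: "0 < w x"
        have "\<bar>g x * b x\<bar> = (l * \<bar>g x\<bar> * w x powr (1 / r)) * ((1 / l) * \<bar>h x\<bar>)"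
          using l w by (simp add: h_def abs_mult powr_minus)
        also have "\<dots> \<le> (l * \<bar>g x\<bar> * w x powr (1 / r)) powr r / r + ((1 / l) * \<bar>h x\<bar>) powr s / s"
          using 3 l by (intro Youngs_inequality) auto
        also have "\<dots> = l powr r / r * (\<bar>g x\<bar> powr r * w x) + (1 / l) powr s / s * \<bar>h x\<bar> powr s"
          using 3 w by (simp add: powr_mult powr_powr powr_divide)
        finally have "ennreal \<bar>g x * b x\<bar> \<le>
            ennreal (l powr r / r * (\<bar>g x\<bar> powr r * w x) + (1 / l) powr s / s * \<bar>h x\<bar> powr s)"
          by (rule ennreal_leI)
        also have "\<dots> = ennreal (l powr r / r) * ennreal (\<bar>g x\<bar> powr r * w x)
                + ennreal ((1 / l) powr s / s) * ennreal (\<bar>h x\<bar> powr s)"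
          using w 3 l by (intro split) auto
        finally show "ennreal \<bar>g x * b x\<bar> \<le> \<dots>" .
      qed
      also have "\<dots> = ennreal (l powr r / r) * ennreal A + ennreal ((1 / l) powr s / s) * ennreal B"
        by (simp add: nn_integral_add nn_integral_cmult A B)
      also have "\<dots> = ennreal (l powr r / r * A + (1 / l) powr s / s * B)"
        using 3 \<open>0 \<le> A\<close> \<open>0 \<le> B\<close> by (intro split[symmetric]) auto
      also have "l powr r / r * A + (1 / l) powr s / s * B = (1 / r + B / s) * A powr (1 / r)"
        using e1 unfolding e2 by (simp add: algebra_simps flip: e1)
      also have "ennreal \<dots> \<le> ennreal (C * A powr (1 / r))"
        by (intro ennreal_leI mult_right_mono) (auto simp: C_def)
      finally show ?thesis .
    qed
    then show "(\<integral>\<^sup>+ x. ennreal \<bar>g x * b x\<bar> \<partial>M)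
        \<le> ennreal (C * enn2real (\<integral>\<^sup>+ x. ennreal (\<bar>g x\<bar> powr r * w x) \<partial>M) powr (1 / r))"
      by (simp add: A_def)
  qed
qed

text \<open>\<open>enn2real \<top>\<close> is 0, so the weight enters as \<open>w powr 0\<close>,
  which is 1 wherever w is positive; the conjugate exponent is 1.\<close>

lemma dual_weighted_top_integrable:
  assumes q: "1 / \<top> + 1 / q = 1"
    and w[measurable]: "w \<in> borel_measurable M" and pos: "AE x in M. 0 < w x"
    and b: "b \<in> dual_weighted \<top> q M w"
  shows "integrable M b"
proof (rule integrableI_bounded)
  show [measurable]: "b \<in> borel_measurable M" using b by (rule dual_weighted_measurable)
  have q: "q = 1" using q by (cases rule: conjugate_exponents_cases) auto
  have "(\<integral>\<^sup>+ x. ennreal (norm (b x)) \<partial>M) = (\<integral>\<^sup>+ x. ennreal (\<bar>b x * w x powr 0\<bar>) \<partial>M)"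
    by (rule nn_integral_cong_AE, use pos in eventually_elim) auto
  also have "\<dots> < \<infinity>"
    using b q by (simp add: dual_weighted_def weighted_Lp_finite_iff)
  finally show "(\<integral>\<^sup>+ x. ennreal (norm (b x)) \<partial>M) < \<infinity>" .
qed

lemma Holder_integrable:
  assumes pq: "1 / p + 1 / q = 1"
    and w[measurable]: "w \<in> borel_measurable M" and pos: "AE x in M. 0 < w x"
    and g: "g \<in> weighted_Lp p M w" and b: "b \<in> dual_weighted p q M w"
  shows "integrable M (\<lambda>x. g x * b x)"
proof (cases "p = \<top>")
  case True
  obtain C where "AE x in M. \<bar>g x\<bar> \<le> C"
    using g True by (auto simp: weighted_Lp_infinity_iff)
  then show ?thesis
    using dual_weighted_top_integrable[OF pq[unfolded True] w pos b[unfolded True]]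
      weighted_Lp_measurable[OF g]
    by (intro Bochner_Integration.integrable_bound[where g="\<lambda>x. g x * b x" and f="\<lambda>x. C * b x"])
      (auto simp: abs_mult dual_weighted_measurable[OF b] intro!: mult_right_mono)
next
  case False
  then have p: "p < \<infinity>" by (simp add: less_top)
  note [measurable] = dual_weighted_measurable[OF b] weighted_Lp_measurable[OF g]
  show ?thesis
  proof (rule integrableI_bounded)
    have fin: "(\<integral>\<^sup>+ x. ennreal (\<bar>g x\<bar> powr enn2real p * w x) \<partial>M) < \<infinity>"
      using g p by (simp add: weighted_Lp_finite_iff)
    obtain C where "\<forall>g\<in>borel_measurable M.
      (\<integral>\<^sup>+ x. ennreal (\<bar>g x\<bar> powr enn2real p * w x) \<partial>M) < \<infinity> \<longrightarrow>
      (\<integral>\<^sup>+ x. ennreal \<bar>g x * b x\<bar> \<partial>M)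
        \<le> ennreal (C * enn2real (\<integral>\<^sup>+ x. ennreal (\<bar>g x\<bar> powr enn2real p * w x) \<partial>M) powr (1 / enn2real p))"
      using Holder_bound_ex[OF pq p w pos b] by blast
    with fin have "(\<integral>\<^sup>+ x. ennreal \<bar>g x * b x\<bar> \<partial>M)
        \<le> ennreal (C * enn2real (\<integral>\<^sup>+ x. ennreal (\<bar>g x\<bar> powr enn2real p * w x) \<partial>M) powr (1 / enn2real p))"
      by simp
    also have "\<dots> < \<infinity>" by simp
    finally show "(\<integral>\<^sup>+ x. ennreal (norm (g x * b x)) \<partial>M) < \<infinity>" by simp
  qed measurable
qed

text \<open>The p-th power of Hoelder's bound is linear in the weighted integral of g, so it can be
  integrated over further variables. If that integral is infinite, positivity of \<open>C\<close>
  makes the right side infinite.\<close>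

lemma Holder_integral_bound_ex:
  fixes M :: "'a measure"
  assumes pq: "1 / p + 1 / q = 1" and p: "p < \<infinity>"
    and w: "w \<in> borel_measurable M" and pos: "AE x in M. 0 < w x"
    and b: "b \<in> dual_weighted p q M w"
  shows "\<exists>C>0. \<forall>g\<in>borel_measurable M. ennreal (\<bar>\<integral>x. g x * b x \<partial>M\<bar> powr enn2real p)
      \<le> ennreal C * (\<integral>\<^sup>+ x. ennreal (\<bar>g x\<bar> powr enn2real p * w x) \<partial>M)"
proof -
  define r where "r = enn2real p"
  have r: "r > 0" using pq p by (cases rule: conjugate_exponents_cases) (auto simp: r_def)
  obtain C where C: "C \<ge> 1" and bd: "\<And>g. g \<in> borel_measurable M \<Longrightarrow>
      (\<integral>\<^sup>+ x. ennreal (\<bar>g x\<bar> powr r * w x) \<partial>M) < \<infinity> \<Longrightarrow>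
      (\<integral>\<^sup>+ x. ennreal \<bar>g x * b x\<bar> \<partial>M)
        \<le> ennreal (C * enn2real (\<integral>\<^sup>+ x. ennreal (\<bar>g x\<bar> powr r * w x) \<partial>M) powr (1 / r))"
    using Holder_bound_ex[OF pq p w pos b] unfolding r_def by blast
  show ?thesis
    unfolding r_def[symmetric]
  proof (intro exI[of _ "C powr r"] conjI ballI)
    show "0 < C powr r" using C by simp
    fix g :: "'a \<Rightarrow> real" assume g: "g \<in> borel_measurable M"
    define A where "A = (\<integral>\<^sup>+ x. ennreal (\<bar>g x\<bar> powr r * w x) \<partial>M)"
    show "ennreal (\<bar>\<integral>x. g x * b x \<partial>M\<bar> powr r) \<le> ennreal (C powr r) * A"
    proof (cases "A < \<infinity>")
      case True
      have "ennreal \<bar>\<integral>x. g x * b x \<partial>M\<bar> \<le> ennreal (C * enn2real A powr (1 / r))"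
        using norm_integral_le_nn_integral bd[OF g True[unfolded A_def]] unfolding A_def
        by (rule order_trans)
      then have "\<bar>\<integral>x. g x * b x \<partial>M\<bar> \<le> C * enn2real A powr (1 / r)"
        using C by (subst (asm) ennreal_le_iff) auto
      then have "\<bar>\<integral>x. g x * b x \<partial>M\<bar> powr r \<le> (C * enn2real A powr (1 / r)) powr r"
        using r by (intro powr_mono2) auto
      also have "\<dots> = C powr r * enn2real A"
        using r by (simp add: powr_mult powr_powr)
      finally have "ennreal (\<bar>\<integral>x. g x * b x \<partial>M\<bar> powr r) \<le> ennreal (C powr r * enn2real A)"
        by (rule ennreal_leI)
      then show ?thesis using True by (simp add: ennreal_mult)
    next
      case False
      then have "A = \<top>" by (simp add: not_less top_unique)
      with C show ?thesis by (simp add: ennreal_mult_top)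
    qed
  qed
qed

section \<open>Almost everywhere statements, Lp functions and partial integrals on finite
  products\<close>

context product_sigma_finite
begin

text \<open>The exceptional set lies in a box with one null side. Such a box is null even if other
  sides have infinite measure, since 0 times infinity is 0.\<close>

lemma AE_PiM_finite_component:
  assumes I: "finite I" "i \<in> I" and P: "AE x in M i. P x"
  shows "AE x in PiM I M. P (x i)"
proof -
  obtain N where N: "N \<in> null_sets (M i)" "{x \<in> space (M i). \<not> P x} \<subseteq> N"
    using P by (auto simp: eventually_ae_filter)
  define E where "E = (\<Pi>\<^sub>E j\<in>I. if j = i then N else space (M j))"
  have [measurable]: "N \<in> sets (M i)" using N by auto
  have "emeasure (PiM I M) E = (\<Prod>j\<in>I. emeasure (M j) (if j = i then N else space (M j)))"
    unfolding E_def using I by (intro emeasure_PiM) auto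
  also have "\<dots> = 0" using I N by (auto simp: prod_zero_iff)
  finally have "E \<in> null_sets (PiM I M)"
    unfolding E_def using I by (intro null_setsI sets_PiM_I_finite) auto
  moreover have "{x \<in> space (PiM I M). \<not> P (x i)} \<subseteq> E"
    using N I by (auto simp: E_def space_PiM PiE_def extensional_def Pi_def split: if_splits)
  ultimately show ?thesis by (auto simp: eventually_ae_filter)
qed

lemma AE_PiM_finite_all:
  assumes "finite I" and "\<And>i. i \<in> I \<Longrightarrow> AE x in M i. P i x"
  shows "AE x in PiM I M. \<forall>i\<in>I. P i (x i)"
  using assms by (intro AE_finite_allI AE_PiM_finite_component) auto

text \<open>By Tonelli the q-th power of a product of functions in separate variables integrates to
  a product; for q = \<top> the product of the bounds is a bound.\<close>

lemma Lp_prod: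
  assumes I: "finite I" and f: "\<And>i. i \<in> I \<Longrightarrow> f i \<in> Lp q (M i)"
  shows "(\<lambda>x. \<Prod>i\<in>I. f i (x i)) \<in> Lp q (PiM I M)"
proof -
  have [measurable]: "f i \<in> borel_measurable (M i)" if "i \<in> I" for i
    using f[OF that] by (rule weighted_Lp_measurable)
  have meas: "(\<lambda>x. \<Prod>i\<in>I. f i (x i)) \<in> borel_measurable (PiM I M)" by measurable
  show ?thesis
  proof (cases "q = \<top>")
    case True
    have "\<forall>i\<in>I. \<exists>C. AE x in M i. \<bar>f i x\<bar> \<le> C"
      using f True by (auto simp: weighted_Lp_infinity_iff)
    then obtain C where C: "\<And>i. i \<in> I \<Longrightarrow> AE x in M i. \<bar>f i x\<bar> \<le> C i" by metis
    have "AE x in PiM I M. \<forall>i\<in>I. \<bar>f i (x i)\<bar> \<le> C i"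
      using I C by (rule AE_PiM_finite_all)
    then have "AE x in PiM I M. \<bar>\<Prod>i\<in>I. f i (x i)\<bar> \<le> (\<Prod>i\<in>I. C i)"
      by eventually_elim (auto simp: abs_prod intro!: prod_mono)
    with meas True show ?thesis by (auto simp: weighted_Lp_infinity_iff)
  next
    case False
    then have q: "q < \<infinity>" by (simp add: less_top)
    have "(\<integral>\<^sup>+ x. ennreal (\<bar>\<Prod>i\<in>I. f i (x i)\<bar> powr enn2real q * 1) \<partial>PiM I M)
        = (\<integral>\<^sup>+ x. (\<Prod>i\<in>I. ennreal (\<bar>f i (x i)\<bar> powr enn2real q)) \<partial>PiM I M)"
      by (simp add: abs_prod prod_powr_distrib prod_ennreal)
    also have "\<dots> = (\<Prod>i\<in>I. \<integral>\<^sup>+ x. ennreal (\<bar>f i x\<bar> powr enn2real q) \<partial>M i)"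
      using I by (intro product_nn_integral_prod) auto
    also have "\<dots> < \<infinity>"
      using f q by (simp add: less_top[symmetric] ennreal_prod_eq_top weighted_Lp_finite_iff)
    finally show ?thesis using meas q by (simp add: weighted_Lp_finite_iff)
  qed
qed

lemma dual_weighted_prod:
  assumes I: "finite I" and f: "\<And>i. i \<in> I \<Longrightarrow> f i \<in> dual_weighted p q (M i) (w i)"
  shows "(\<lambda>x. \<Prod>i\<in>I. f i (x i)) \<in> dual_weighted p q (PiM I M) (\<lambda>x. \<Prod>i\<in>I. w i (x i))"
proof -
  have [measurable]: "f i \<in> borel_measurable (M i)" if "i \<in> I" for i
    using f[OF that] by (rule dual_weighted_measurable)
  have "(\<lambda>x. \<Prod>i\<in>I. f i (x i) * w i (x i) powr (- 1 / enn2real p)) \<in> Lp q (PiM I M)"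
    using I f by (intro Lp_prod) (auto simp: dual_weighted_def)
  then show ?thesis
    by (simp add: dual_weighted_def prod.distrib prod_powr_distrib)
qed

text \<open>Hoelder in y for fixed x, followed by Tonelli. The constant comes from b alone and is
  therefore the same for every section of g. For p = \<top>, a null set of the product has null
  sections for almost every x.\<close>

lemma partial_integral_weighted_Lp:
  assumes pq: "1 / p + 1 / q = 1" and IJ: "I \<inter> J = {}" "finite I" "finite J"
    and w: "\<And>i. w i \<in> borel_measurable (M i)" "\<And>i. AE x in M i. 0 < w i x"
      "\<And>i x. x \<in> space (M i) \<Longrightarrow> 0 \<le> w i x"
    and g: "g \<in> weighted_Lp p (PiM (I \<union> J) M) (\<lambda>x. \<Prod>i\<in>I \<union> J. w i (x i))"
    and b: "b \<in> dual_weighted p q (PiM J M) (\<lambda>x. \<Prod>i\<in>J. w i (x i))"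
  shows "(\<lambda>x. \<integral>y. g (merge I J (x, y)) * b y \<partial>PiM J M)
      \<in> weighted_Lp p (PiM I M) (\<lambda>x. \<Prod>i\<in>I. w i (x i))"
proof -
  interpret I: finite_product_sigma_finite M I by standard fact
  interpret J: finite_product_sigma_finite M J by standard fact
  interpret P: pair_sigma_finite "PiM I M" "PiM J M" ..
  note [measurable] = w(1) dual_weighted_measurable[OF b] weighted_Lp_measurable[OF g]
  have gm[measurable]: "(\<lambda>z. g (merge I J z)) \<in> borel_measurable (PiM I M \<Otimes>\<^sub>M PiM J M)"
    by measurable
  have meas: "(\<lambda>x. \<integral>y. g (merge I J (x, y)) * b y \<partial>PiM J M) \<in> borel_measurable (PiM I M)"
    by measurable
  have posJ: "AE x in PiM J M. 0 < (\<Prod>i\<in>J. w i (x i))"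
    using AE_PiM_finite_all[of J "\<lambda>i x. 0 < w i x", OF IJ(3) w(2)]
    by eventually_elim (auto intro: prod_pos)
  have wJ: "(\<lambda>x. \<Prod>i\<in>J. w i (x i)) \<in> borel_measurable (PiM J M)" by measurable
  show ?thesis
  proof (cases "p = \<top>")
    case True
    have int: "integrable (PiM J M) b"
      using dual_weighted_top_integrable[OF pq[unfolded True] wJ posJ] b True by simp
    obtain C where C: "AE x in PiM (I \<union> J) M. \<bar>g x\<bar> \<le> C"
      using g True by (auto simp: weighted_Lp_infinity_iff)
    \<comment> \<open>The merge map carries the pair measure to the measure on the union, so the
      bound on g pulls back to pairs.\<close>
    have "AE z in PiM I M \<Otimes>\<^sub>M PiM J M. \<bar>g (merge I J z)\<bar> \<le> C"
      using C by (subst (asm) distr_merge[OF IJ, symmetric]) (erule AE_distrD[rotated], measurable)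
    then have "AE x in PiM I M. AE y in PiM J M. \<bar>g (merge I J (x, y))\<bar> \<le> C"
      by (rule P.AE_pair)
    then have "AE x in PiM I M. \<bar>\<integral>y. g (merge I J (x, y)) * b y \<partial>PiM J M\<bar> \<le> (\<integral>y. C * \<bar>b y\<bar> \<partial>PiM J M)"
    proof eventually_elim
      case (elim x)
      then show ?case
      proof (subst real_norm_def[symmetric], intro Bochner_Integration.integral_norm_bound[THEN order_trans] integral_mono_AE')
        show "integrable (PiM J M) (\<lambda>y. C * \<bar>b y\<bar>)" using int by simp
        show "AE y in PiM J M. norm (g (merge I J (x, y)) * b y) \<le> C * \<bar>b y\<bar>"
          using elim by eventually_elim (auto simp: abs_mult mult_right_mono)
      qed auto
    qed
    with meas True show ?thesis by (auto simp: weighted_Lp_infinity_iff)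
  next
    case False
    then have p: "p < \<infinity>" by (simp add: less_top)
    define r where "r = enn2real p"
    obtain C where C: "C > 0" and bd: "\<And>h. h \<in> borel_measurable (PiM J M) \<Longrightarrow>
        ennreal (\<bar>\<integral>y. h y * b y \<partial>PiM J M\<bar> powr r)
          \<le> ennreal C * (\<integral>\<^sup>+ y. ennreal (\<bar>h y\<bar> powr r * (\<Prod>i\<in>J. w i (y i))) \<partial>PiM J M)"
      using Holder_integral_bound_ex[OF pq p wJ posJ b] unfolding r_def by blast
    have nonneg: "0 \<le> (\<Prod>i\<in>K. w i (x i))" if "x \<in> space (PiM K M)" for x K
      using that w(3) by (auto intro!: prod_nonneg simp: space_PiM PiE_iff)
    have "(\<integral>\<^sup>+ x. ennreal (\<bar>\<integral>y. g (merge I J (x, y)) * b y \<partial>PiM J M\<bar> powr r * (\<Prod>i\<in>I. w i (x i))) \<partial>PiM I M)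
        \<le> (\<integral>\<^sup>+ x. ennreal C * (\<integral>\<^sup>+ y. ennreal (\<bar>g (merge I J (x, y))\<bar> powr r *
              (\<Prod>i\<in>I \<union> J. w i (merge I J (x, y) i))) \<partial>PiM J M) \<partial>PiM I M)"
    proof (rule nn_integral_mono)
      fix x assume x: "x \<in> space (PiM I M)"
      then have [measurable]: "(\<lambda>y. g (merge I J (x, y))) \<in> borel_measurable (PiM J M)"
        by measurable
      have split: "(\<Prod>i\<in>I \<union> J. w i (merge I J (x, y) i)) = (\<Prod>i\<in>I. w i (x i)) * (\<Prod>i\<in>J. w i (y i))" for y
        using IJ by (auto simp: prod.union_disjoint merge_def intro!: arg_cong2[where f="(*)"] prod.cong)
      have "ennreal (\<bar>\<integral>y. g (merge I J (x, y)) * b y \<partial>PiM J M\<bar> powr r * (\<Prod>i\<in>I. w i (x i)))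
          = ennreal (\<bar>\<integral>y. g (merge I J (x, y)) * b y \<partial>PiM J M\<bar> powr r) * ennreal (\<Prod>i\<in>I. w i (x i))"
        by (simp add: ennreal_mult nonneg x)
      also have "\<dots> \<le> (ennreal C * (\<integral>\<^sup>+ y. ennreal (\<bar>g (merge I J (x, y))\<bar> powr r * (\<Prod>i\<in>J. w i (y i))) \<partial>PiM J M))
          * ennreal (\<Prod>i\<in>I. w i (x i))"
        by (intro mult_right_mono bd) auto
      also have "\<dots> = ennreal C * (\<integral>\<^sup>+ y. ennreal (\<bar>g (merge I J (x, y))\<bar> powr r * (\<Prod>i\<in>J. w i (y i)))
          * ennreal (\<Prod>i\<in>I. w i (x i)) \<partial>PiM J M)"
        by (subst nn_integral_multc) (auto simp: mult.assoc)
      also have "\<dots> = ennreal C * (\<integral>\<^sup>+ y. ennreal (\<bar>g (merge I J (x, y))\<bar> powr r *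
              (\<Prod>i\<in>I \<union> J. w i (merge I J (x, y) i))) \<partial>PiM J M)"
        unfolding split
        by (intro arg_cong2[where f="(*)"] nn_integral_cong refl)
          (auto simp: nonneg x mult_ac simp flip: ennreal_mult)
      finally show "ennreal (\<bar>\<integral>y. g (merge I J (x, y)) * b y \<partial>PiM J M\<bar> powr r * (\<Prod>i\<in>I. w i (x i))) \<le> \<dots>" .
    qed
    also have "\<dots> = ennreal C * (\<integral>\<^sup>+ x. (\<integral>\<^sup>+ y. ennreal (\<bar>g (merge I J (x, y))\<bar> powr r *
              (\<Prod>i\<in>I \<union> J. w i (merge I J (x, y) i))) \<partial>PiM J M) \<partial>PiM I M)"
      by (rule nn_integral_cmult) measurable
    also have "\<dots> = ennreal C * (\<integral>\<^sup>+ x. ennreal (\<bar>g x\<bar> powr r * (\<Prod>i\<in>I \<union> J. w i (x i))) \<partial>PiM (I \<union> J) M)"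
      by (subst product_nn_integral_fold[OF IJ, symmetric]) auto
    also have "\<dots> < \<infinity>"
      using g p by (auto simp: weighted_Lp_finite_iff r_def ennreal_mult_less_top)
    finally show ?thesis
      using meas p by (simp add: weighted_Lp_finite_iff r_def)
  qed
qed

end

section \<open>Change of kernel\<close>

lemma sigma_finite_lebesgue_on:
  assumes "S \<in> sets lebesgue"
  shows "sigma_finite_measure (lebesgue_on S)"
proof (rule sigma_finite_measure_restrict_space[OF _ assms])
  show "sigma_finite_measure (lebesgue :: 'a measure)"
  proof
    obtain A :: "'a set set" where A: "countable A" "A \<subseteq> sets lborel" "\<Union>A = space lborel"
      "\<forall>a\<in>A. emeasure lborel a \<noteq> \<infinity>"
      using lborel.sigma_finite_countable by blast
    then show "\<exists>A::'a set set. countable A \<and> A \<subseteq> sets lebesgue \<and> \<Union>A = space lebesgue \<and>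
        (\<forall>a\<in>A. emeasure lebesgue a \<noteq> \<infinity>)"
      by (intro exI[of _ A]) (auto simp: subset_eq)
  qed
qed

lemma positive_density_integrable: "positive_density D \<psi> \<Longrightarrow> integrable (lebesgue_on D) \<psi>"
  by (rule integrableI_nonneg) (auto simp: positive_density_def intro!: AE_I2)

lemma tail_eq_integral:
  assumes "D \<in> sets lebesgue"
  shows "tail D \<psi> t = (\<integral>x. indicator {t..} x *\<^sub>R \<psi> x \<partial>lebesgue_on D)"
proof -
  have "lebesgue_on (D \<inter> {t..}) = restrict_space (lebesgue_on D) {t..}"
    using assms by (subst restrict_restrict_space) auto
  moreover have "{t..} \<inter> D \<in> sets (lebesgue_on D)"
    using assms by (auto simp: sets_restrict_space_iff)
  ultimately show ?thesis
    unfolding tail_def by (simp add: integral_restrict_space)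
qed

text \<open>A larger t means a smaller domain of integration for a non-negative function, so the
  tail is antitone and hence Borel.\<close>

lemma tail_measurable:
  assumes D: "D \<in> sets lebesgue" and dens: "positive_density D \<psi>"
  shows "tail D \<psi> \<in> borel_measurable (lebesgue_on D)"
proof -
  have int: "integrable (lebesgue_on D) (\<lambda>x. indicator {t..} x *\<^sub>R \<psi> x)" for t
  proof -
    have "{t..} \<inter> D \<in> sets (lebesgue_on D)"
      using D by (auto simp: sets_restrict_space_iff)
    then have "integrable (lebesgue_on D) (\<lambda>x. indicator ({t..} \<inter> D) x *\<^sub>R \<psi> x)"
      using positive_density_integrable[OF dens] by (rule integrable_mult_indicator)
    also have "?this \<longleftrightarrow> ?thesis"
      by (intro Bochner_Integration.integrable_cong) (auto simp: indicator_def)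
    finally show ?thesis .
  qed
  have "mono (\<lambda>t. - tail D \<psi> t)"
  proof (rule monoI, simp, unfold tail_eq_integral[OF D])
    fix s t :: real assume "s \<le> t"
    then show "(\<integral>x. indicator {t..} x *\<^sub>R \<psi> x \<partial>lebesgue_on D) \<le> (\<integral>x. indicator {s..} x *\<^sub>R \<psi> x \<partial>lebesgue_on D)"
      using dens by (intro integral_mono int) (auto simp: indicator_def positive_density_def)
  qed
  then have "(\<lambda>t. - tail D \<psi> t) \<in> borel_measurable borel" by (rule borel_measurable_mono)
  then have "tail D \<psi> \<in> borel_measurable borel" by simp
  then show ?thesis by (simp add: measurable_completion measurable_restrict_space1)
qed

section \<open>Shifted kernels, dual functions and the expansion of one kernel in another\<close>

definition shifted_kernel :: "(real \<Rightarrow> real) \<Rightarrow> real \<Rightarrow> real \<Rightarrow> real" where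
  "shifted_kernel c x t = indicator {0..<x} t - c t"

text \<open>The last two assumptions are the form in which condition (I) is used, the same for
  finite and infinite p: the kernels are built from functions that pair with the weighted L_p space.
  Here \<open>q\<close> is the conjugate index of p; the outer index of \<open>W_space\<close> is
  called \<open>r\<close> in the lemmas below.\<close>

locale weighted_interval =
  fixes D :: "real set" and p q :: ennreal and \<psi> :: "real \<Rightarrow> real"
  assumes D_lebesgue[measurable]: "D \<in> sets lebesgue"
    and zero_in_D: "0 \<in> D" and D_pos: "\<exists>a\<in>D. 0 < a"
    and D_nonneg: "x \<in> D \<Longrightarrow> 0 \<le> x"
    and D_downward: "x \<in> D \<Longrightarrow> 0 \<le> y \<Longrightarrow> y \<le> x \<Longrightarrow> y \<in> D"
    and density: "positive_density D \<psi>"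
    and conj_exp: "1 / p + 1 / q = 1"
    and dual_indicator: "x \<in> D \<Longrightarrow> indicator {0..<x} \<in> dual_weighted p q (lebesgue_on D) \<psi>"
    and dual_tail: "tail D \<psi> \<in> dual_weighted p q (lebesgue_on D) \<psi>"
begin

sublocale lebesgue_D: sigma_finite_measure "lebesgue_on D"
  by (rule sigma_finite_lebesgue_on) measurable

sublocale product_sigma_finite "\<lambda>_::nat. lebesgue_on D"
  by standard

abbreviation "dual \<equiv> dual_weighted p q (lebesgue_on D) \<psi>"

lemma psi_measurable[measurable]: "\<psi> \<in> borel_measurable (lebesgue_on D)"
  and psi_nonneg: "t \<in> D \<Longrightarrow> 0 \<le> \<psi> t"
  and psi_nn_integral: "(\<integral>\<^sup>+ t. ennreal (\<psi> t) \<partial>lebesgue_on D) = 1"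
  and psi_pos: "AE t in lebesgue_on D. 0 < \<psi> t"
  using density by (auto simp: positive_density_def)

lemma prod_psi_measurable[measurable]: "(\<lambda>t. \<Prod>j\<in>u. \<psi> (t j)) \<in> borel_measurable (leb_pow u D)"
  by measurable

lemma prod_psi_pos: "finite u \<Longrightarrow> AE t in leb_pow u D. 0 < (\<Prod>j\<in>u. \<psi> (t j))"
  using AE_PiM_finite_all[of u "\<lambda>_ x. 0 < \<psi> x"] psi_pos
  by (auto elim!: eventually_mono intro!: prod_pos)

lemma prod_dual:
  assumes "finite u" "\<And>j. j \<in> u \<Longrightarrow> f j \<in> dual"
  shows "(\<lambda>t. \<Prod>j\<in>u. f j (t j)) \<in> dual_weighted p q (leb_pow u D) (\<lambda>t. \<Prod>j\<in>u. \<psi> (t j))"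
  using assms by (rule dual_weighted_prod)

text \<open>Hoelder on the product: a product of dual functions is dual for the product
  weight.\<close>

lemma integrable_Lp_psi_dual:
  assumes "finite u" "g \<in> Lp_psi D p \<psi> u" "\<And>j. j \<in> u \<Longrightarrow> f j \<in> dual"
  shows "integrable (leb_pow u D) (\<lambda>t. g t * (\<Prod>j\<in>u. f j (t j)))"
  using assms prod_dual[of u f] prod_psi_pos[of u]
  by (intro Holder_integrable[OF conj_exp prod_psi_measurable]) (auto simp: Lp_psi_def)

text \<open>This domination makes both \<open>shifted_kernel c x\<close> and the differences c - c'
  dual functions; 0 and \<open>tail D \<psi>\<close> are the two extreme cases.\<close>

definition tail_bounded :: "(real \<Rightarrow> real) \<Rightarrow> bool" where
  "tail_bounded c \<longleftrightarrow> c \<in> borel_measurable (lebesgue_on D) \<and> (\<forall>t\<in>D. 0 \<le> c t \<and> c t \<le> tail D \<psi> t)"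

lemma tail_bounded_measurable: "tail_bounded c \<Longrightarrow> c \<in> borel_measurable (lebesgue_on D)"
  by (simp add: tail_bounded_def)

lemma diff_dual:
  assumes "tail_bounded c" "tail_bounded c'"
  shows "(\<lambda>t. c t - c' t) \<in> dual"
  using assms
  by (intro dual_weighted_dominated[OF dual_tail]) (fastforce simp: tail_bounded_def intro!: AE_I2)+

lemma shifted_kernel_dual:
  assumes c: "tail_bounded c" and x: "x \<in> D"
  shows "shifted_kernel c x \<in> dual"
proof -
  note [measurable] = tail_bounded_measurable[OF c] dual_weighted_measurable[OF dual_indicator[OF x]]
  have "(\<lambda>t. indicator {0..<x} t + tail D \<psi> t) \<in> dual"
    using dual_indicator[OF x] dual_tail by (rule dual_weighted_add)
  then show ?thesis
  proof (rule dual_weighted_dominated)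
    show "shifted_kernel c x \<in> borel_measurable (lebesgue_on D)"
      unfolding shifted_kernel_def by measurable
    have "\<bar>shifted_kernel c x t\<bar> \<le> \<bar>indicator {0..<x} t + tail D \<psi> t\<bar>" if "t \<in> D" for t
    proof -
      have "0 \<le> c t" "c t \<le> tail D \<psi> t" using c that by (auto simp: tail_bounded_def)
      then show ?thesis by (auto simp: shifted_kernel_def indicator_def)
    qed
    then show "AE t in lebesgue_on D. \<bar>shifted_kernel c x t\<bar> \<le> \<bar>indicator {0..<x} t + tail D \<psi> t\<bar>"
      by (intro AE_I2) simp
  qed measurable
qed

lemma integrable_T_op:
  assumes "finite u" "tail_bounded c" "g \<in> Lp_psi D p \<psi> u" "\<And>j. j \<in> u \<Longrightarrow> x j \<in> D"
  shows "integrable (leb_pow u D) (\<lambda>t. g t * (\<Prod>j\<in>u. shifted_kernel c (x j) (t j)))"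
  using assms by (intro integrable_Lp_psi_dual shifted_kernel_dual) auto

text \<open>The function g_v of the expansion, with e = c' - c: the variables in which the factor e
  was chosen are integrated out.\<close>

definition partial_integral :: "(real \<Rightarrow> real) \<Rightarrow> nat set \<Rightarrow> nat set \<Rightarrow> ((nat \<Rightarrow> real) \<Rightarrow> real) \<Rightarrow>
    (nat \<Rightarrow> real) \<Rightarrow> real" where
  "partial_integral e u v g t =
     (\<integral>s. g (merge v (u - v) (t, s)) * (\<Prod>j\<in>u - v. e (s j)) \<partial>leb_pow (u - v) D)"

lemma partial_integral_Lp_psi:
  assumes "finite u" "v \<subseteq> u" "e \<in> dual" "g \<in> Lp_psi D p \<psi> u"
  shows "partial_integral e u v g \<in> Lp_psi D p \<psi> v"
proof -
  have [simp]: "v \<union> u = u" using assms by auto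
  show ?thesis
    unfolding partial_integral_def Lp_psi_def
    using assms psi_pos psi_nonneg
    by (intro partial_integral_weighted_Lp[OF conj_exp] prod_dual)
      (auto simp: Lp_psi_def intro: finite_subset)
qed

lemma T_op_expand:
  assumes u: "finite u" and c: "tail_bounded c" and c': "tail_bounded c'"
    and g: "g \<in> Lp_psi D p \<psi> u" and x: "\<And>j. j \<in> u \<Longrightarrow> x j \<in> D"
  shows "T_op (shifted_kernel c) D u g x =
    (\<Sum>v\<in>Pow u. T_op (shifted_kernel c') D v (partial_integral (\<lambda>t. c' t - c t) u v g) x)"
proof -
  define e where "e = (\<lambda>t. c' t - c t)"
  have e: "e \<in> dual" unfolding e_def using c' c by (rule diff_dual)
  \<comment> \<open>Each term of the expansion becomes one product over all of u, so that its
    integrability is a single instance of pairing g with dual functions.\<close>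
  define f where "f v j = (if j \<in> v then shifted_kernel c' (x j) else e)" for v j
  have f: "f v j \<in> dual" if "j \<in> u" for v j
    using that e shifted_kernel_dual[OF c' x[OF that]] by (simp add: f_def)
  have int: "integrable (leb_pow u D) (\<lambda>t. g t * (\<Prod>j\<in>u. f v j (t j)))" for v
    using u g f by (rule integrable_Lp_psi_dual)
  have "T_op (shifted_kernel c) D u g x = (\<integral>t. (\<Sum>v\<in>Pow u. g t * (\<Prod>j\<in>u. f v j (t j))) \<partial>leb_pow u D)"
    unfolding T_op_def
  proof (rule Bochner_Integration.integral_cong[OF refl])
    fix t
    have "(\<Prod>j\<in>u. shifted_kernel c (x j) (t j)) = (\<Prod>j\<in>u. shifted_kernel c' (x j) (t j) + e (t j))"
      by (simp add: shifted_kernel_def e_def)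
    also have "\<dots> = (\<Sum>v\<in>Pow u. (\<Prod>j\<in>v. shifted_kernel c' (x j) (t j)) * (\<Prod>j\<in>u - v. e (t j)))"
      using u by (rule prod_add)
    also have "\<dots> = (\<Sum>v\<in>Pow u. \<Prod>j\<in>u. f v j (t j))"
    proof (rule sum.cong[OF refl])
      fix v assume "v \<in> Pow u"
      then have "(\<Prod>j\<in>u. f v j (t j)) = (\<Prod>j\<in>v. f v j (t j)) * (\<Prod>j\<in>u - v. f v j (t j))"
        using u by (simp add: prod.subset_diff mult.commute)
      then show "(\<Prod>j\<in>v. shifted_kernel c' (x j) (t j)) * (\<Prod>j\<in>u - v. e (t j)) = (\<Prod>j\<in>u. f v j (t j))"
        by (simp add: f_def)
    qed
    finally show "g t * (\<Prod>j\<in>u. shifted_kernel c (x j) (t j)) = (\<Sum>v\<in>Pow u. g t * (\<Prod>j\<in>u. f v j (t j)))"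
      by (simp add: sum_distrib_left)
  qed
  also have "\<dots> = (\<Sum>v\<in>Pow u. \<integral>t. g t * (\<Prod>j\<in>u. f v j (t j)) \<partial>leb_pow u D)"
    using int by (rule Bochner_Integration.integral_sum)
  also have "\<dots> = (\<Sum>v\<in>Pow u. T_op (shifted_kernel c') D v (partial_integral e u v g) x)"
  proof (rule sum.cong[OF refl])
    fix v assume "v \<in> Pow u"
    then have v: "v \<subseteq> u" "v \<union> (u - v) = u" "finite v" using u finite_subset by auto
    \<comment> \<open>Fubini separates the inner variables u - v, which carry the factors e, from
      the outer variables v, which carry the kernel for c'.\<close>
    have "(\<integral>t. g t * (\<Prod>j\<in>u. f v j (t j)) \<partial>leb_pow u D) =
      (\<integral>t. (\<integral>s. g (merge v (u - v) (t, s)) * (\<Prod>j\<in>u. f v j (merge v (u - v) (t, s) j)) \<partial>leb_pow (u - v) D) \<partial>leb_pow v D)"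
      using product_integral_fold[of v "u - v" "\<lambda>t. g t * (\<Prod>j\<in>u. f v j (t j))"] int[of v] u v
      by simp
    also have "\<dots> = (\<integral>t. (\<integral>s. (g (merge v (u - v) (t, s)) * (\<Prod>j\<in>u - v. e (s j)))
        * (\<Prod>j\<in>v. shifted_kernel c' (x j) (t j)) \<partial>leb_pow (u - v) D) \<partial>leb_pow v D)"
    proof -
      have "(\<Prod>j\<in>u. f v j (merge v (u - v) (t, s) j)) =
          (\<Prod>j\<in>u - v. e (s j)) * (\<Prod>j\<in>v. shifted_kernel c' (x j) (t j))" for t s
        using u v by (subst prod.subset_diff[OF v(1) u])
          (auto simp: f_def merge_def intro!: arg_cong2[where f="(*)"] prod.cong)
      then show ?thesis by (simp add: mult.assoc)
    qed
    also have "\<dots> = T_op (shifted_kernel c') D v (partial_integral e u v g) x"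
      by (simp add: T_op_def partial_integral_def)
    finally show "(\<integral>t. g t * (\<Prod>j\<in>u. f v j (t j)) \<partial>leb_pow u D) = \<dots>" .
  qed
  finally show ?thesis by (simp add: e_def)
qed

lemma zero_in_F_space: "finite u \<Longrightarrow> (\<lambda>x\<in>cube d D. 0) \<in> F_space K d D p \<psi> u"
proof -
  assume "finite u"
  have "(\<lambda>_. 0) \<in> Lp_psi D p \<psi> u"
    by (cases "p = \<top>") (auto simp: Lp_psi_def weighted_Lp_infinity_iff weighted_Lp_finite_iff less_top)
  then show ?thesis unfolding F_space_def by (rule rev_image_eqI) (auto simp: T_op_def)
qed

lemma F_space_add:
  assumes u: "u \<subseteq> {1..d}" and c: "tail_bounded c"
    and f: "f \<in> F_space (shifted_kernel c) d D p \<psi> u" and g: "g \<in> F_space (shifted_kernel c) d D p \<psi> u"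
  shows "(\<lambda>x\<in>cube d D. f x + g x) \<in> F_space (shifted_kernel c) d D p \<psi> u"
proof -
  have fin: "finite u" using u finite_subset by blast
  obtain f' where f': "f' \<in> Lp_psi D p \<psi> u" "f = restrict (T_op (shifted_kernel c) D u f') (cube d D)"
    using f by (auto simp: F_space_def)
  obtain g' where g': "g' \<in> Lp_psi D p \<psi> u" "g = restrict (T_op (shifted_kernel c) D u g') (cube d D)"
    using g by (auto simp: F_space_def)
  have "(\<lambda>t. f' t + g' t) \<in> Lp_psi D p \<psi> u"
    using f' g' unfolding Lp_psi_def by (intro weighted_Lp_add) auto
  moreover have "T_op (shifted_kernel c) D u (\<lambda>t. f' t + g' t) x = f x + g x" if "x \<in> cube d D" for x
  proof -
    have x: "x j \<in> D" if "j \<in> u" for j using \<open>x \<in> cube d D\<close> u that by (auto simp: PiE_iff)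
    show ?thesis
      using integrable_T_op[OF fin c f'(1) x] integrable_T_op[OF fin c g'(1) x] f' g' that
      by (simp add: T_op_def distrib_right)
  qed
  ultimately show ?thesis
    unfolding F_space_def by (intro rev_image_eqI) (auto intro!: restrict_ext)
qed

lemma F_space_sum:
  assumes u: "u \<subseteq> {1..d}" and c: "tail_bounded c"
    and A: "finite A" "\<And>a. a \<in> A \<Longrightarrow> f a \<in> F_space (shifted_kernel c) d D p \<psi> u"
  shows "(\<lambda>x\<in>cube d D. \<Sum>a\<in>A. f a x) \<in> F_space (shifted_kernel c) d D p \<psi> u"
  using A
proof (induction A rule: finite_induct)
  case empty
  have "finite u" using u finite_subset by blast
  from zero_in_F_space[OF this, of d "shifted_kernel c"] show ?case by (simp add: restrict_def)
next
  case (insert a A)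
  then have "(\<lambda>x\<in>cube d D. f a x + (\<lambda>x\<in>cube d D. \<Sum>a\<in>A. f a x) x) \<in> F_space (shifted_kernel c) d D p \<psi> u"
    using u c by (intro F_space_add) auto
  also have "(\<lambda>x\<in>cube d D. f a x + (\<lambda>x\<in>cube d D. \<Sum>a\<in>A. f a x) x) = (\<lambda>x\<in>cube d D. \<Sum>a\<in>insert a A. f a x)"
    using insert by (intro restrict_ext) simp
  finally show ?case .
qed

lemma finite_active: "finite (active d \<gamma>)"
  by (rule finite_subset[of _ "Pow {1..d}"]) (auto simp: active_def)

lemma W_space_subset:
  assumes dc: "downward_closed_weights d \<gamma>" and c: "tail_bounded c" and c': "tail_bounded c'"
  shows "W_space (shifted_kernel c) d D p r \<psi> \<gamma> \<subseteq> W_space (shifted_kernel c') d D p r \<psi> \<gamma>"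
proof
  fix F assume "F \<in> W_space (shifted_kernel c) d D p r \<psi> \<gamma>"
  then obtain f where F: "F = (\<lambda>x\<in>cube d D. \<Sum>u\<in>active d \<gamma>. f u x)"
    and f: "\<forall>u\<in>active d \<gamma>. f u \<in> F_space (shifted_kernel c) d D p \<psi> u"
    by (auto simp: W_space_def)
  have "\<forall>u\<in>active d \<gamma>. \<exists>g\<in>Lp_psi D p \<psi> u. f u = restrict (T_op (shifted_kernel c) D u g) (cube d D)"
    using f by (auto simp: F_space_def)
  then obtain g where g: "\<And>u. u \<in> active d \<gamma> \<Longrightarrow> g u \<in> Lp_psi D p \<psi> u"
    and fg: "\<And>u. u \<in> active d \<gamma> \<Longrightarrow> f u = restrict (T_op (shifted_kernel c) D u (g u)) (cube d D)"
    by metis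
  define h where "h u v = restrict (T_op (shifted_kernel c') D v
      (partial_integral (\<lambda>t. c' t - c t) u v (g u))) (cube d D)" for u v
  \<comment> \<open>The component for v collects what all active supersets of v contribute.\<close>
  define f' where "f' v = (\<lambda>x\<in>cube d D. \<Sum>u\<in>{u \<in> active d \<gamma>. v \<subseteq> u}. h u v x)" for v
  have fin: "finite u" "u \<subseteq> {1..d}" if "u \<in> active d \<gamma>" for u
    using that finite_subset[of u "{1..d}"] by (auto simp: active_def)
  have sub: "v \<in> active d \<gamma>" if "u \<in> active d \<gamma>" "v \<subseteq> u" for u v
    using dc that by (auto simp: active_def downward_closed_weights_def)
  have "f' v \<in> F_space (shifted_kernel c') d D p \<psi> v" if "v \<in> active d \<gamma>" for v
    unfolding f'_def
  proof (rule F_space_sum[OF _ c'])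
    show "h u v \<in> F_space (shifted_kernel c') d D p \<psi> v" if "u \<in> {u \<in> active d \<gamma>. v \<subseteq> u}" for u
      unfolding h_def F_space_def using that fin g diff_dual[OF c' c]
      by (intro imageI partial_integral_Lp_psi) auto
  qed (use that fin finite_active in auto)
  moreover have "F = (\<lambda>x\<in>cube d D. \<Sum>v\<in>active d \<gamma>. f' v x)"
    unfolding F
  proof (rule restrict_ext)
    fix x assume x: "x \<in> cube d D"
    have "(\<Sum>u\<in>active d \<gamma>. f u x) = (\<Sum>u\<in>active d \<gamma>. \<Sum>v\<in>Pow u. h u v x)"
    proof (rule sum.cong[OF refl])
      fix u assume u: "u \<in> active d \<gamma>"
      have "x j \<in> D" if "j \<in> u" for j using x fin(2)[OF u] that by (auto simp: PiE_iff)
      then show "f u x = (\<Sum>v\<in>Pow u. h u v x)"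
        using T_op_expand[OF fin(1)[OF u] c c' g[OF u], of x] x by (simp add: fg u h_def)
    qed
    \<comment> \<open>Downward closure enters here: every subset of an active set is active, so the
      inner sum runs over active sets only and the order of summation can be exchanged.\<close>
    also have "\<dots> = (\<Sum>u\<in>active d \<gamma>. \<Sum>v\<in>{v\<in>active d \<gamma>. v \<subseteq> u}. h u v x)"
      by (intro sum.cong refl) (use sub in auto)
    also have "\<dots> = (\<Sum>v\<in>active d \<gamma>. \<Sum>u\<in>{u\<in>active d \<gamma>. v \<subseteq> u}. h u v x)"
      by (rule sum.swap_restrict) (auto simp: finite_active)
    also have "\<dots> = (\<Sum>v\<in>active d \<gamma>. f' v x)" using x by (simp add: f'_def)
    finally show "(\<Sum>u\<in>active d \<gamma>. f u x) = \<dots>" .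
  qed
  ultimately show "F \<in> W_space (shifted_kernel c') d D p r \<psi> \<gamma>"
    by (auto simp: W_space_def)
qed

section \<open>Detecting a component\<close>

text \<open>This makes c the complementary distribution function of \<mu>. As c t is the
  \<mu>-integral over x of the indicator of [0,x) at t, \<open>shifted_kernel c\<close> has
  \<mu>-mean zero in x for every t in D.\<close>

definition tail_of :: "real measure \<Rightarrow> (real \<Rightarrow> real) \<Rightarrow> bool" where
  "tail_of \<mu> c \<longleftrightarrow> prob_space \<mu> \<and> sets \<mu> = sets (lebesgue_on D) \<and>
     (\<forall>t\<in>D. measure \<mu> {x \<in> D. t < x} = c t)"

text \<open>The uniform distribution on {0, a}, placed on the sigma-algebra of
  \<open>lebesgue_on D\<close> so that it matches \<mu> in the other coordinates.\<close>

definition two_point :: "real \<Rightarrow> real measure" where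
  "two_point a = distr (measure_pmf (bernoulli_pmf (1 / 2))) (lebesgue_on D) (\<lambda>b. if b then a else 0)"

definition jump :: "real \<Rightarrow> real \<Rightarrow> real" where
  "jump a x = indicator {a} x - indicator {0} x"

lemma id_measurable_D[measurable]: "(\<lambda>x. x) \<in> borel_measurable (lebesgue_on D)"
  using id_borel_measurable_lebesgue_on[of D] by (simp add: id_def)

lemma jump_measurable[measurable]: "jump a \<in> borel_measurable (lebesgue_on D)"
  unfolding jump_def by measurable

context
  fixes a :: real
  assumes a: "a \<in> D" "0 < a"
begin

lemma two_point_map_measurable:
  "(\<lambda>b. if b then a else 0) \<in> measurable (measure_pmf (bernoulli_pmf (1 / 2))) (lebesgue_on D)"
  using a zero_in_D by (auto simp: measurable_def)

lemma prob_space_two_point: "prob_space (two_point a)"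
  unfolding two_point_def
  by (intro measure_pmf.prob_space_distr two_point_map_measurable)

lemma sets_two_point[measurable_cong]: "sets (two_point a) = sets (lebesgue_on D)"
  by (simp add: two_point_def)

lemma nn_integral_two_point:
  fixes f :: "real \<Rightarrow> ennreal"
  shows "f \<in> borel_measurable (lebesgue_on D) \<Longrightarrow> (\<integral>\<^sup>+ x. f x \<partial>two_point a) = (f a + f 0) / 2"
  unfolding two_point_def
  by (subst nn_integral_distr[OF two_point_map_measurable])
    (auto simp: ennreal_divide_times distrib_right divide_ennreal_def)

lemma integral_two_point:
  fixes f :: "real \<Rightarrow> real"
  shows "f \<in> borel_measurable (lebesgue_on D) \<Longrightarrow> (\<integral>x. f x \<partial>two_point a) = (f a + f 0) / 2"
  unfolding two_point_def
  by (subst integral_distr[OF two_point_map_measurable]) auto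

end

lemma shifted_kernel_measurable_fst:
  "(\<lambda>x. shifted_kernel c x t) \<in> borel_measurable (lebesgue_on D)"
proof -
  have "(\<lambda>x. shifted_kernel c x t) = (\<lambda>x. (if 0 \<le> t \<and> t < x then 1 else 0) - c t)"
    by (auto simp: shifted_kernel_def)
  then show ?thesis by simp
qed

text \<open>
  The signed measure \<open>\<delta>\<^sub>a - \<delta>\<^sub>0\<close> is represented as twice \<open>jump a\<close> times the uniform distribution on
  \<open>{0, a}\<close>, so that products of probability measures suffice.
\<close>

definition component_measure :: "real measure \<Rightarrow> real \<Rightarrow> nat set \<Rightarrow> nat \<Rightarrow> real measure" where
  "component_measure \<mu> a u j = (if j \<in> u then two_point a else \<mu>)"

text \<open>The result of one coordinate of the functional on the kernel for c', with e = c - c'. It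
  is 0 for j in u - v, because \<delta>_a - \<delta>_0 kills constants in x; for e = 0 it is 0 also
  for j in v - u, so for equal kernels only v = u survives. The 1/2 is the mass of each point of {0,
  a}.\<close>

definition component_factor :: "(real \<Rightarrow> real) \<Rightarrow> real \<Rightarrow> nat set \<Rightarrow> nat set \<Rightarrow> nat \<Rightarrow> real \<Rightarrow> real" where
  "component_factor e a u v j s =
    (if j \<in> u then if j \<in> v then indicator {0..<a} s / 2 else 0 else if j \<in> v then e s else 1)"

definition component_integrand :: "(real \<Rightarrow> real) \<Rightarrow> real \<Rightarrow> nat set \<Rightarrow> nat set \<Rightarrow> nat \<Rightarrow> real \<Rightarrow> real \<Rightarrow> real" where
  "component_integrand c a u v j x s =
    (if j \<in> u then jump a x else 1) * (if j \<in> v then shifted_kernel c x s else 1)"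

text \<open>A bound for the absolute x-integral in one coordinate, valid in all cases and built from
  dual functions. The factor 2 covers c + c'.\<close>

definition component_bound :: "real \<Rightarrow> nat set \<Rightarrow> nat \<Rightarrow> real \<Rightarrow> real" where
  "component_bound a v j s = (if j \<in> v then indicator {0..<a} s + 2 * tail D \<psi> s else 1)"

lemma component_integrand_measurable:
  "(\<lambda>x. component_integrand c a u v j x s) \<in> borel_measurable (lebesgue_on D)"
  unfolding component_integrand_def using shifted_kernel_measurable_fst by measurable

text \<open>For j in v: in a coordinate from u the shift c' s cancels between x = a and x = 0; in
  the others the \<mu>-mean of the indicator is c s, which leaves c s - c' s.\<close>

lemma component_integrand_estimates:
  assumes mu: "tail_of \<mu> c" and c: "tail_bounded c" and c': "tail_bounded c'"
    and a: "a \<in> D" "0 < a" and s: "j \<in> v \<Longrightarrow> s \<in> D"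
  shows component_nn_integral_le: "(\<integral>\<^sup>+ x. ennreal \<bar>component_integrand c' a u v j x s\<bar>
      \<partial>component_measure \<mu> a u j) \<le> ennreal (component_bound a v j s)" (is ?le)
    and component_integral: "(\<integral>x. component_integrand c' a u v j x s \<partial>component_measure \<mu> a u j) =
      component_factor (\<lambda>t. c t - c' t) a u v j s" (is ?eq)
proof -
  note [measurable] = component_integrand_measurable[of c' a u v j s]
  interpret mu: prob_space \<mu> using mu by (simp add: tail_of_def)
  have sets[measurable_cong]: "sets \<mu> = sets (lebesgue_on D)" using mu by (simp add: tail_of_def)
  have space: "space \<mu> = D" using sets_eq_imp_space_eq[OF sets] by simp
  have tail: "0 \<le> c s" "c s \<le> tail D \<psi> s" "0 \<le> c' s" "c' s \<le> tail D \<psi> s" "0 \<le> s" if "j \<in> v"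
    using s[OF that] c c' D_nonneg by (auto simp: tail_bounded_def)
  have "?le \<and> ?eq"
  proof (cases "j \<in> u")
    case True
    then have R: "component_measure \<mu> a u j = two_point a" by (simp add: component_measure_def)
    have vals: "component_integrand c' a u v j a s = (if j \<in> v then shifted_kernel c' a s else 1)"
      "component_integrand c' a u v j 0 s = - (if j \<in> v then shifted_kernel c' 0 s else 1)"
      using True a by (auto simp: component_integrand_def jump_def)
    have ?eq
      unfolding R using True
      by (subst integral_two_point[OF a])
        (auto simp: vals component_factor_def shifted_kernel_def)
    moreover have ?le
    proof -
      have "(\<integral>\<^sup>+ x. ennreal \<bar>component_integrand c' a u v j x s\<bar> \<partial>two_point a)
          = (ennreal \<bar>component_integrand c' a u v j a s\<bar> + ennreal \<bar>component_integrand c' a u v j 0 s\<bar>) / 2"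
        by (rule nn_integral_two_point[OF a]) measurable
      also have "\<dots> = ennreal ((\<bar>component_integrand c' a u v j a s\<bar> + \<bar>component_integrand c' a u v j 0 s\<bar>) / 2)"
        by (simp flip: ennreal_plus add: divide_ennreal[symmetric])
      also have "\<dots> \<le> ennreal (component_bound a v j s)"
        using tail unfolding vals
        by (intro ennreal_leI) (auto simp: component_bound_def shifted_kernel_def indicator_def)
      finally show ?thesis unfolding R .
    qed
    ultimately show ?thesis by simp
  next
    case False
    then have R: "component_measure \<mu> a u j = \<mu>" by (simp add: component_measure_def)
    show ?thesis
    proof (cases "j \<in> v")
      case True
      have set: "{x \<in> D. s < x} \<in> sets \<mu>"
      proof -
        have "{x \<in> space (lebesgue_on D). s < x} \<in> sets (lebesgue_on D)" by measurable
        then show ?thesis unfolding sets by simp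
      qed
      \<comment> \<open>For s \<ge> 0, membership of s in [0,x) means s < x, so the kernel is the
        indicator of a half-line in x, up to the shift.\<close>
      have val: "component_integrand c' a u v j x s = indicator {x \<in> D. s < x} x - c' s"
        if "x \<in> D" for x
        using False True that tail by (auto simp: component_integrand_def shifted_kernel_def indicator_def)
      have meas: "measure \<mu> {x \<in> D. s < x} = c s" using mu s[OF True] by (simp add: tail_of_def)
      have "(\<integral>x. component_integrand c' a u v j x s \<partial>\<mu>) = (\<integral>x. indicator {x \<in> D. s < x} x - c' s \<partial>\<mu>)"
        by (rule Bochner_Integration.integral_cong[OF refl]) (simp add: space val)
      also have "\<dots> = c s - c' s"
        using set by (subst Bochner_Integration.integral_diff) (auto simp: meas mu.prob_space mu.emeasure_eq_measure)
      finally have ?eq unfolding R using True False by (simp add: component_factor_def)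
      moreover have ?le
      proof -
        have "(\<integral>\<^sup>+ x. ennreal \<bar>component_integrand c' a u v j x s\<bar> \<partial>\<mu>)
            \<le> (\<integral>\<^sup>+ x. indicator {x \<in> D. s < x} x + ennreal (c' s) \<partial>\<mu>)"
        proof (rule nn_integral_mono)
          fix x assume "x \<in> space \<mu>"
          then show "ennreal \<bar>component_integrand c' a u v j x s\<bar> \<le> indicator {x \<in> D. s < x} x + ennreal (c' s)"
            using tail[OF True] val[of x] space
            by (cases "s < x") (auto simp flip: ennreal_plus ennreal_1 intro!: ennreal_leI)
        qed
        also have "\<dots> = ennreal (c s) + ennreal (c' s)"
          using set by (subst nn_integral_add) (auto simp: mu.emeasure_eq_measure meas mu.prob_space)
        also have "\<dots> = ennreal (c s + c' s)"
          using tail[OF True] by simp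
        also have "\<dots> \<le> ennreal (component_bound a v j s)"
          using tail[OF True] True by (intro ennreal_leI) (auto simp: component_bound_def indicator_def)
        finally show ?thesis unfolding R .
      qed
      ultimately show ?thesis by simp
    next
      case nv: False
      then show ?thesis unfolding R using False
        by (simp add: component_integrand_def component_factor_def component_bound_def
            mu.prob_space mu.emeasure_space_1)
    qed
  qed
  then show ?le ?eq by auto
qed

text \<open>Fubini moves the functional inside the integral defining \<open>T_op\<close>, where both
  the measure and the integrand factor over the coordinates.\<close>

lemma component_functional:
  assumes mu: "tail_of \<mu> c" and c: "tail_bounded c" and c': "tail_bounded c'"
    and a: "a \<in> D" "0 < a" and u: "u \<subseteq> {1..d}" and v: "v \<subseteq> {1..d}" and g: "g \<in> Lp_psi D p \<psi> v"
  defines "Q \<equiv> PiM {1..d} (component_measure \<mu> a u)"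
  shows component_functional_integrable:
      "integrable Q (\<lambda>x. (\<Prod>j\<in>u. jump a (x j)) * T_op (shifted_kernel c') D v g x)" (is ?int)
    and component_functional_eq:
      "(\<integral>x. (\<Prod>j\<in>u. jump a (x j)) * T_op (shifted_kernel c') D v g x \<partial>Q) =
        (\<integral>t. g t * (\<Prod>j\<in>{1..d}. component_factor (\<lambda>t. c t - c' t) a u v j (t j)) \<partial>leb_pow v D)" (is ?eq)
proof -
  have fin: "finite u" "finite v" using u v finite_subset by auto
  define R where "R = component_measure \<mu> a u"
  have sets_R[measurable_cong]: "sets (R j) = sets (lebesgue_on D)" for j
    using mu by (simp add: R_def component_measure_def sets_two_point[OF a] tail_of_def)
  have space_R: "space (R j) = D" for j
    using sets_eq_imp_space_eq[OF sets_R] by simp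
  have prob_R: "prob_space (R j)" for j
    using mu by (simp add: R_def component_measure_def prob_space_two_point[OF a] tail_of_def)
  interpret R: product_prob_space R
    by (intro product_prob_spaceI prob_R)
  interpret Q: finite_product_prob_space R "{1..d}" by standard simp
  interpret V: finite_product_sigma_finite "\<lambda>_::nat. lebesgue_on D" v by standard (rule fin)
  interpret P: pair_sigma_finite "PiM {1..d} R" "leb_pow v D" ..
  note [measurable] = tail_bounded_measurable[OF c'] weighted_Lp_measurable[OF g[unfolded Lp_psi_def]]
  define H where "H = component_integrand c' a u v"
  have H_meas[measurable]: "(\<lambda>x. H j x s) \<in> borel_measurable (R j)" for j s
    unfolding H_def using component_integrand_measurable by measurable
  \<comment> \<open>Factors 1 extend the products over u and v to all d coordinates, matching the
    product measure.\<close>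
  have H_prod: "(\<Prod>j\<in>u. jump a (x j)) * (g t * (\<Prod>j\<in>v. shifted_kernel c' (x j) (t j)))
      = g t * (\<Prod>j\<in>{1..d}. H j (x j) (t j))" for x t
  proof -
    have restr: "(\<Prod>j\<in>{1..d}. if j \<in> k then f j else 1) = (\<Prod>j\<in>k. f j)" if "k \<subseteq> {1..d}" for k and f :: "nat \<Rightarrow> real"
      using that by (simp add: prod.inter_restrict[symmetric] inf.absorb2)
    show ?thesis
      unfolding H_def component_integrand_def prod.distrib by (simp only: restr[OF u] restr[OF v] mult_ac)
  qed
  define F where "F x t = (\<Prod>j\<in>u. jump a (x j)) * (g t * (\<Prod>j\<in>v. shifted_kernel c' (x j) (t j)))" for x t
  have coord: "(\<lambda>z. fst z j) \<in> borel_measurable (PiM {1..d} R \<Otimes>\<^sub>M leb_pow v D)" if "j \<in> {1..d}" for j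
  proof -
    have "(\<lambda>x. x) \<in> borel_measurable (R j)" by measurable
    then show ?thesis using that by measurable
  qed
  have coord2: "(\<lambda>z. snd z j) \<in> measurable (PiM {1..d} R \<Otimes>\<^sub>M leb_pow v D) (lebesgue_on D)" if "j \<in> v" for j
    using that by measurable
  have F_meas[measurable]: "case_prod F \<in> borel_measurable (PiM {1..d} R \<Otimes>\<^sub>M leb_pow v D)"
  proof -
    have "(\<lambda>z. jump a (fst z j)) \<in> borel_measurable (PiM {1..d} R \<Otimes>\<^sub>M leb_pow v D)" if "j \<in> u" for j
    proof -
      have "jump a \<in> borel_measurable (R j)" by measurable
      moreover have "(\<lambda>z. fst z j) \<in> measurable (PiM {1..d} R \<Otimes>\<^sub>M leb_pow v D) (R j)"
      proof -
        have "j \<in> {1..d}" using that u by auto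
        then show ?thesis by measurable
      qed
      ultimately show ?thesis by (rule measurable_compose[rotated])
    qed
    moreover have "(\<lambda>z. shifted_kernel c' (fst z j) (snd z j)) \<in> borel_measurable (PiM {1..d} R \<Otimes>\<^sub>M leb_pow v D)"
      if "j \<in> v" for j
    proof -
      have [measurable]: "(\<lambda>z. fst z j) \<in> borel_measurable (PiM {1..d} R \<Otimes>\<^sub>M leb_pow v D)"
        "(\<lambda>z. snd z j) \<in> borel_measurable (PiM {1..d} R \<Otimes>\<^sub>M leb_pow v D)"
        using coord[of j] measurable_compose[OF coord2[OF that] id_measurable_D] v that by auto
      have [measurable]: "(\<lambda>z. c' (snd z j)) \<in> borel_measurable (PiM {1..d} R \<Otimes>\<^sub>M leb_pow v D)"
        using measurable_compose[OF coord2[OF that] tail_bounded_measurable[OF c']] .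
      \<comment> \<open>For joint measurability, membership in [0,x) becomes a comparison of two
        measurable coordinate functions.\<close>
      have eq: "(\<lambda>z. shifted_kernel c' (fst z j) (snd z j)) =
          (\<lambda>z. (if 0 \<le> snd z j \<and> snd z j < fst z j then 1 else 0) - c' (snd z j))"
        by (auto simp: shifted_kernel_def)
      show ?thesis unfolding eq by measurable
    qed
    ultimately show ?thesis unfolding F_def case_prod_beta by measurable
  qed
  have t_D: "t j \<in> D" if "t \<in> space (leb_pow v D)" "j \<in> v" for t j
    using that by (auto simp: space_PiM PiE_iff)
  \<comment> \<open>Tonelli with x integrated first: the coordinate bounds then leave g against a
    product of dual functions in t, which is integrable.\<close>
  have F_int: "integrable (PiM {1..d} R \<Otimes>\<^sub>M leb_pow v D) (case_prod F)"
  proof (rule integrableI_bounded[OF F_meas])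
    have meas: "(\<lambda>z. ennreal (norm (case_prod F z))) \<in> borel_measurable (PiM {1..d} R \<Otimes>\<^sub>M leb_pow v D)"
      by measurable
    have "(\<integral>\<^sup>+ z. ennreal (norm (case_prod F z)) \<partial>(PiM {1..d} R \<Otimes>\<^sub>M leb_pow v D))
        = (\<integral>\<^sup>+ t. \<integral>\<^sup>+ x. ennreal \<bar>F x t\<bar> \<partial>PiM {1..d} R \<partial>leb_pow v D)"
      by (subst P.nn_integral_snd[OF meas, symmetric]) simp
    also have "\<dots> \<le> (\<integral>\<^sup>+ t. ennreal \<bar>g t * (\<Prod>j\<in>v. indicator {0..<a} (t j) + 2 * tail D \<psi> (t j))\<bar> \<partial>leb_pow v D)"
    proof (rule nn_integral_mono)
      fix t assume t: "t \<in> space (leb_pow v D)"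
      have tail_nonneg: "0 \<le> tail D \<psi> (t j)" if "j \<in> v" for j
        using c t_D[OF t that] order_trans unfolding tail_bounded_def by blast
      have "(\<integral>\<^sup>+ x. ennreal \<bar>F x t\<bar> \<partial>PiM {1..d} R)
          = (\<integral>\<^sup>+ x. ennreal \<bar>g t\<bar> * (\<Prod>j\<in>{1..d}. ennreal \<bar>H j (x j) (t j)\<bar>) \<partial>PiM {1..d} R)"
        by (simp add: F_def H_prod abs_mult abs_prod ennreal_mult prod_ennreal prod_nonneg)
      also have "\<dots> = ennreal \<bar>g t\<bar> * (\<integral>\<^sup>+ x. (\<Prod>j\<in>{1..d}. ennreal \<bar>H j (x j) (t j)\<bar>) \<partial>PiM {1..d} R)"
        by (rule nn_integral_cmult) measurable
      also have "(\<integral>\<^sup>+ x. (\<Prod>j\<in>{1..d}. ennreal \<bar>H j (x j) (t j)\<bar>) \<partial>PiM {1..d} R)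
          = (\<Prod>j\<in>{1..d}. \<integral>\<^sup>+ x. ennreal \<bar>H j x (t j)\<bar> \<partial>R j)"
        by (rule R.product_nn_integral_prod) (simp, measurable)
      also have "\<dots> \<le> (\<Prod>j\<in>{1..d}. ennreal (component_bound a v j (t j)))"
        unfolding H_def R_def
        by (intro prod_mono_ennreal component_nn_integral_le[OF mu c c' a] t_D[OF t])
      also have "\<dots> = ennreal (\<Prod>j\<in>{1..d}. component_bound a v j (t j))"
        using tail_nonneg by (intro prod_ennreal) (auto simp: component_bound_def)
      also have "(\<Prod>j\<in>{1..d}. component_bound a v j (t j))
          = (\<Prod>j\<in>v. indicator {0..<a} (t j) + 2 * tail D \<psi> (t j))"
        using v by (simp add: component_bound_def prod.inter_restrict[symmetric] inf.absorb2)
      finally show "(\<integral>\<^sup>+ x. ennreal \<bar>F x t\<bar> \<partial>PiM {1..d} R)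
          \<le> ennreal \<bar>g t * (\<Prod>j\<in>v. indicator {0..<a} (t j) + 2 * tail D \<psi> (t j))\<bar>"
        using tail_nonneg by (simp add: abs_mult ennreal_mult mult_left_mono prod_nonneg)
    qed
    also have "\<dots> < \<infinity>"
    proof -
      have "(\<lambda>s. indicator {0..<a} s + (tail D \<psi> s + tail D \<psi> s)) \<in> dual"
        by (intro dual_weighted_add dual_indicator dual_tail a)
      then have "(\<lambda>s. indicator {0..<a} s + 2 * tail D \<psi> s) \<in> dual" by (simp only: mult_2)
      then have "integrable (leb_pow v D) (\<lambda>t. g t * (\<Prod>j\<in>v. indicator {0..<a} (t j) + 2 * tail D \<psi> (t j)))"
        by (rule integrable_Lp_psi_dual[OF fin(2) g])
      then show ?thesis by (simp only: integrable_iff_bounded real_norm_def)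
    qed
    finally show "(\<integral>\<^sup>+ z. ennreal (norm (case_prod F z)) \<partial>(PiM {1..d} R \<Otimes>\<^sub>M leb_pow v D)) < \<infinity>" .
  qed
  have T_eq: "(\<integral>t. F x t \<partial>leb_pow v D) = (\<Prod>j\<in>u. jump a (x j)) * T_op (shifted_kernel c') D v g x" for x
    by (simp add: F_def T_op_def)
  show ?int
    using P.integrable_fst[OF F_int] by (simp add: T_eq Q_def R_def)
  have "(\<integral>x. (\<Prod>j\<in>u. jump a (x j)) * T_op (shifted_kernel c') D v g x \<partial>PiM {1..d} R)
      = (\<integral>t. (\<integral>x. F x t \<partial>PiM {1..d} R) \<partial>leb_pow v D)"
    using P.Fubini_integral[OF F_int] by (simp add: T_eq)
  also have "\<dots> = (\<integral>t. g t * (\<Prod>j\<in>{1..d}. component_factor (\<lambda>t. c t - c' t) a u v j (t j)) \<partial>leb_pow v D)"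
  proof (rule Bochner_Integration.integral_cong[OF refl])
    fix t assume t: "t \<in> space (leb_pow v D)"
    have int: "integrable (R j) (\<lambda>x. H j x (t j))" for j
    proof (rule integrableI_bounded[OF H_meas])
      have "(\<integral>\<^sup>+ x. ennreal (norm (H j x (t j))) \<partial>R j) \<le> ennreal (component_bound a v j (t j))"
        using component_nn_integral_le[OF mu c c' a, of j v "t j" u] t_D[OF t] by (simp add: H_def R_def)
      also have "\<dots> < \<infinity>" by simp
      finally show "(\<integral>\<^sup>+ x. ennreal (norm (H j x (t j))) \<partial>R j) < \<infinity>" .
    qed
    have "(\<integral>x. F x t \<partial>PiM {1..d} R) = g t * (\<integral>x. (\<Prod>j\<in>{1..d}. H j (x j) (t j)) \<partial>PiM {1..d} R)"
      by (simp add: F_def H_prod)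
    also have "\<dots> = g t * (\<Prod>j\<in>{1..d}. \<integral>x. H j x (t j) \<partial>R j)"
      using int by (subst R.product_integral_prod) auto
    also have "\<dots> = g t * (\<Prod>j\<in>{1..d}. component_factor (\<lambda>t. c t - c' t) a u v j (t j))"
      unfolding H_def R_def
      by (intro arg_cong2[where f="(*)"] prod.cong refl component_integral[OF mu c c' a] t_D[OF t])
    finally show "(\<integral>x. F x t \<partial>PiM {1..d} R) = \<dots>" .
  qed
  finally show ?eq by (simp add: Q_def R_def)
qed

section \<open>Probability measures representing the two kernels, and positivity of the tail\<close>

definition psi_measure :: "real measure" where
  "psi_measure = density (lebesgue_on D) (\<lambda>t. ennreal (\<psi> t))"

lemma prob_space_psi_measure: "prob_space psi_measure"
proof (rule prob_spaceI)
  have "emeasure psi_measure (space psi_measure) = (\<integral>\<^sup>+ t. ennreal (\<psi> t) * indicator D t \<partial>lebesgue_on D)"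
    by (simp add: psi_measure_def emeasure_density)
  also have "\<dots> = (\<integral>\<^sup>+ t. ennreal (\<psi> t) \<partial>lebesgue_on D)"
    by (rule nn_integral_cong) simp
  finally show "emeasure psi_measure (space psi_measure) = 1" by (simp add: psi_nn_integral)
qed

lemma AE_neq_lebesgue_on: "AE x in lebesgue_on D. x \<noteq> t"
proof (rule AE_I[where N="{t} \<inter> D"])
  show "emeasure (lebesgue_on D) ({t} \<inter> D) = 0"
    by (cases "t \<in> D") (auto simp: emeasure_restrict_space)
  show "{t} \<inter> D \<in> sets (lebesgue_on D)"
    by (cases "t \<in> D") (auto simp: sets_restrict_space_iff)
qed auto

lemma half_line_sets: "{x \<in> D. t < x} \<in> sets (lebesgue_on D)"
proof -
  have "{x \<in> space (lebesgue_on D). t < x} \<in> sets (lebesgue_on D)" by measurable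
  then show ?thesis by simp
qed

text \<open>\<open>tail\<close> integrates over the closed half-line from t, while
  \<open>tail_of\<close> measures the open one; they differ by at most one point, a null
  set.\<close>

lemma tail_eq_nn_integral:
  "ennreal (tail D \<psi> t) = (\<integral>\<^sup>+ x. ennreal (\<psi> x) * indicator {x \<in> D. t < x} x \<partial>lebesgue_on D)"
  "0 \<le> tail D \<psi> t"
proof -
  note half_line_sets[measurable]
  have "tail D \<psi> t = (\<integral>x. indicator {t..} x *\<^sub>R \<psi> x \<partial>lebesgue_on D)"
    by (rule tail_eq_integral) (rule D_lebesgue)
  also have "\<dots> = (\<integral>x. \<psi> x * indicator {x \<in> D. t < x} x \<partial>lebesgue_on D)"
  proof (rule integral_cong_AE)
    show "(\<lambda>x. indicator {t..} x *\<^sub>R \<psi> x) \<in> borel_measurable (lebesgue_on D)"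
    proof -
      have "(\<lambda>x. indicator {t..} x *\<^sub>R \<psi> x) = (\<lambda>x. if t \<le> x then \<psi> x else 0)"
        by (auto simp: indicator_def)
      then show ?thesis by simp
    qed
    show "AE x in lebesgue_on D. indicator {t..} x *\<^sub>R \<psi> x = \<psi> x * indicator {x \<in> D. t < x} x"
      using AE_neq_lebesgue_on[of t] AE_space by eventually_elim (auto simp: indicator_def)
  qed measurable
  finally have eq: "tail D \<psi> t = (\<integral>x. \<psi> x * indicator {x \<in> D. t < x} x \<partial>lebesgue_on D)" .
  have int': "integrable (lebesgue_on D) (\<lambda>x. \<psi> x * indicator {x \<in> D. t < x} x)"
    by (rule integrable_real_mult_indicator[OF half_line_sets positive_density_integrable[OF density]])
  have "(\<integral>\<^sup>+ x. ennreal (\<psi> x) * indicator {x \<in> D. t < x} x \<partial>lebesgue_on D)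
      = (\<integral>\<^sup>+ x. ennreal (\<psi> x * indicator {x \<in> D. t < x} x) \<partial>lebesgue_on D)"
    by (rule nn_integral_cong) (simp split: split_indicator)
  also have "\<dots> = ennreal (tail D \<psi> t)"
    unfolding eq
  proof (rule nn_integral_eq_integral[OF int'])
    show "AE x in lebesgue_on D. 0 \<le> \<psi> x * indicator {x \<in> D. t < x} x"
      using psi_pos by eventually_elim simp
  qed
  finally show "ennreal (tail D \<psi> t) = (\<integral>\<^sup>+ x. ennreal (\<psi> x) * indicator {x \<in> D. t < x} x \<partial>lebesgue_on D)"
    by (rule sym)
  show "0 \<le> tail D \<psi> t"
    unfolding tail_def by (rule Bochner_Integration.integral_nonneg) (simp add: psi_nonneg)
qed

lemma tail_of_tail: "tail_of psi_measure (tail D \<psi>)"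
  unfolding tail_of_def
proof (intro conjI ballI prob_space_psi_measure)
  show "sets psi_measure = sets (lebesgue_on D)" by (simp add: psi_measure_def)
  fix t
  have "emeasure psi_measure {x \<in> D. t < x} = ennreal (tail D \<psi> t)"
    unfolding psi_measure_def tail_eq_nn_integral(1)
    by (rule emeasure_density[OF _ half_line_sets]) measurable
  then show "measure psi_measure {x \<in> D. t < x} = tail D \<psi> t"
    using tail_eq_nn_integral(2)[of t] by (simp add: measure_def)
qed

text \<open>The point mass at 0 gives no mass to the points beyond any t \<ge> 0.\<close>

lemma tail_of_zero: "tail_of (return (lebesgue_on D) 0) (\<lambda>_. 0)"
  unfolding tail_of_def
proof (intro conjI ballI)
  show "prob_space (return (lebesgue_on D) 0)" using zero_in_D by (intro prob_space_return) simp
  fix t assume "t \<in> D"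
  then have "\<not> t < 0" using D_nonneg[of t] by simp
  then show "measure (return (lebesgue_on D) 0) {x \<in> D. t < x} = 0"
    using half_line_sets[of t] by (simp add: measure_return indicator_def)
qed simp

lemma tail_bounded_zero: "tail_bounded (\<lambda>_. 0)"
  using tail_eq_nn_integral(2) by (simp add: tail_bounded_def)

lemma tail_bounded_tail: "tail_bounded (tail D \<psi>)"
  using tail_eq_nn_integral(2) dual_weighted_measurable[OF dual_tail] by (simp add: tail_bounded_def)

text \<open>An open interval of positive length inside D is not null; the positivity arguments below
  end in this contradiction.\<close>

lemma AE_lebesgue_on_interval_False:
  assumes "b \<in> D" "0 \<le> t" "t < b" and AE: "AE x in lebesgue_on D. x \<notin> {t<..<b}"
  shows False
proof -
  have sub: "{t<..<b} \<subseteq> D" using assms D_downward by auto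
  have "AE x in lebesgue. x \<in> D \<longrightarrow> x \<notin> {t<..<b}"
    using AE by (subst (asm) AE_restrict_space_iff) auto
  then have "AE x in lebesgue. x \<notin> {t<..<b}"
    by eventually_elim (use sub in auto)
  then have "{t<..<b} \<in> null_sets lebesgue"
    by (subst (asm) AE_iff_null_sets[symmetric]) auto
  then show False using \<open>t < b\<close> by (auto simp: null_sets_def)
qed

text \<open>If the tail vanished at t, the density would vanish almost everywhere between t and a,
  contrary to its positivity.\<close>

lemma tail_pos:
  assumes a: "a \<in> D" and t: "t < a" "0 \<le> t"
  shows "0 < tail D \<psi> t"
proof (rule ccontr)
  assume "\<not> 0 < tail D \<psi> t"
  then have "tail D \<psi> t = 0" using tail_eq_nn_integral(2)[of t] by simp
  then have "(\<integral>\<^sup>+ x. ennreal (\<psi> x) * indicator {x \<in> D. t < x} x \<partial>lebesgue_on D) = 0"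
    by (simp flip: tail_eq_nn_integral)
  then have "AE x in lebesgue_on D. ennreal (\<psi> x) * indicator {x \<in> D. t < x} x = 0"
    using half_line_sets by (subst (asm) nn_integral_0_iff_AE) auto
  then have "AE x in lebesgue_on D. \<not> x \<in> {t<..<a}"
    using psi_pos AE_space
    by eventually_elim (auto simp: indicator_def)
  then show False
    by (rule AE_lebesgue_on_interval_False[OF a t(2,1)])
qed

lemma one_in_Lp_psi: "finite u \<Longrightarrow> (\<lambda>_. 1) \<in> Lp_psi D p \<psi> u"
proof (cases "p = \<top>")
  case True
  have "AE t in leb_pow u D. \<bar>1\<bar> \<le> (1::real)" by simp
  with True show ?thesis by (auto simp: Lp_psi_def weighted_Lp_infinity_iff)
next
  case False
  assume u: "finite u"
  have "(\<integral>\<^sup>+ t. ennreal (\<Prod>j\<in>u. \<psi> (t j)) \<partial>leb_pow u D) = (\<integral>\<^sup>+ t. (\<Prod>j\<in>u. ennreal (\<psi> (t j))) \<partial>leb_pow u D)"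
    using psi_nonneg by (intro nn_integral_cong prod_ennreal[symmetric]) (auto simp: space_PiM PiE_iff)
  also have "\<dots> = 1"
    using u by (subst product_nn_integral_prod) (auto simp: psi_nn_integral)
  finally show ?thesis using False by (simp add: Lp_psi_def weighted_Lp_finite_iff less_top)
qed

lemma one_in_weighted_Lp: "(\<lambda>_. 1) \<in> weighted_Lp p (lebesgue_on D) \<psi>"
proof (cases "p = \<top>")
  case True
  have "AE t in lebesgue_on D. \<bar>1\<bar> \<le> (1::real)" by simp
  with True show ?thesis by (auto simp: weighted_Lp_infinity_iff)
next
  case False
  then show ?thesis by (simp add: weighted_Lp_finite_iff less_top psi_nn_integral)
qed

text \<open>Pairing with the constant 1, which lies in the weighted L_p space because \<psi> has
  integral 1.\<close>

lemma dual_integrable: "f \<in> dual \<Longrightarrow> integrable (lebesgue_on D) f"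
  using Holder_integrable[OF conj_exp psi_measurable psi_pos one_in_weighted_Lp, of f] by simp

lemma integral_tail_pos: "0 < (\<integral>t. tail D \<psi> t \<partial>lebesgue_on D)"
proof -
  obtain a where a: "a \<in> D" "0 < a" using D_pos by blast
  have int: "integrable (lebesgue_on D) (tail D \<psi>)" using dual_tail by (rule dual_integrable)
  have "(\<integral>t. tail D \<psi> t \<partial>lebesgue_on D) \<noteq> 0"
  proof
    assume "(\<integral>t. tail D \<psi> t \<partial>lebesgue_on D) = 0"
    then have "AE t in lebesgue_on D. tail D \<psi> t = 0"
      using tail_eq_nn_integral(2) int by (subst (asm) integral_nonneg_eq_0_iff_AE) auto
    then have "AE t in lebesgue_on D. \<not> t \<in> {0<..<a}"
      by eventually_elim (use tail_pos[OF a(1)] in force)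
    then show False by (rule AE_lebesgue_on_interval_False[OF a(1) order_refl a(2)])
  qed
  moreover have "0 \<le> (\<integral>t. tail D \<psi> t \<partial>lebesgue_on D)"
    by (rule Bochner_Integration.integral_nonneg) (rule tail_eq_nn_integral(2))
  ultimately show ?thesis by simp
qed

text \<open>Here c belongs to the measure \<mu> used in the functional, so its space is the one
  annihilated; c' supplies the function outside it.\<close>

lemma W_space_not_subset:
  assumes ndc: "\<not> downward_closed_weights d \<gamma>" and c: "tail_bounded c" "tail_of \<mu> c" and c': "tail_bounded c'"
    and ne: "(\<integral>t. c t - c' t \<partial>lebesgue_on D) \<noteq> 0"
  shows "\<not> W_space (shifted_kernel c') d D p r \<psi> \<gamma> \<subseteq> W_space (shifted_kernel c) d D p r \<psi> \<gamma>"
proof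
  assume sub: "W_space (shifted_kernel c') d D p r \<psi> \<gamma> \<subseteq> W_space (shifted_kernel c) d D p r \<psi> \<gamma>"
  obtain w u where w: "w \<subseteq> {1..d}" "w \<in> active d \<gamma>" and u: "u \<subseteq> w" "u \<notin> active d \<gamma>"
    using ndc by (auto simp: downward_closed_weights_def active_def)
  then have u': "u \<subseteq> {1..d}" by blast
  have fin: "finite v" "v \<subseteq> {1..d}" if "v \<in> active d \<gamma>" for v
    using that finite_subset[of v "{1..d}"] by (auto simp: active_def)
  obtain a where a: "a \<in> D" "0 < a" using D_pos by blast
  define Q where "Q = PiM {1..d} (component_measure \<mu> a u)"
  \<comment> \<open>The factors of the functional on the component w. As u is a subset of w, the
    vanishing case of \<open>component_factor\<close> does not occur.\<close>
  define k where "k j s = (if j \<in> u then indicator {0..<a} s / 2 else c s - c' s)" for j s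
  define J where "J x = (\<Prod>j\<in>u. jump a (x j))" for x
  have space_Q: "space Q = cube d D"
  proof -
    have "space (component_measure \<mu> a u j) = D" for j
      using c(2) sets_two_point[OF a]
      by (auto simp: component_measure_def tail_of_def dest!: sets_eq_imp_space_eq)
    then show ?thesis by (simp only: Q_def space_PiM)
  qed
  \<comment> \<open>In the test function all components other than w are zero, and w carries the
    image of the constant 1.\<close>
  define f where "f v = (if v = w then restrict (T_op (shifted_kernel c') D w (\<lambda>_. 1)) (cube d D)
      else (\<lambda>x\<in>cube d D. 0))" for v
  have "\<forall>v\<in>active d \<gamma>. f v \<in> F_space (shifted_kernel c') d D p \<psi> v"
    using zero_in_F_space fin one_in_Lp_psi by (auto simp: f_def F_space_def)
  then have "(\<lambda>x\<in>cube d D. \<Sum>v\<in>active d \<gamma>. f v x) \<in> W_space (shifted_kernel c) d D p r \<psi> \<gamma>"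
    using sub by (auto simp: W_space_def)
  then obtain f' where f': "\<forall>v\<in>active d \<gamma>. f' v \<in> F_space (shifted_kernel c) d D p \<psi> v"
    and eq: "(\<lambda>x\<in>cube d D. \<Sum>v\<in>active d \<gamma>. f v x) = (\<lambda>x\<in>cube d D. \<Sum>v\<in>active d \<gamma>. f' v x)"
    unfolding W_space_def by blast
  obtain h where h: "\<And>v. v \<in> active d \<gamma> \<Longrightarrow> h v \<in> Lp_psi D p \<psi> v"
    and f'h: "\<And>v. v \<in> active d \<gamma> \<Longrightarrow> f' v = restrict (T_op (shifted_kernel c) D v (h v)) (cube d D)"
    using f' unfolding F_space_def image_iff by metis
  have T_eq: "T_op (shifted_kernel c') D w (\<lambda>_. 1) x = (\<Sum>v\<in>active d \<gamma>. T_op (shifted_kernel c) D v (h v) x)"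
    if x: "x \<in> cube d D" for x
  proof -
    have "(\<Sum>v\<in>active d \<gamma>. f v x) = (\<Sum>v\<in>active d \<gamma>. f' v x)"
      using fun_cong[OF eq, of x] x by simp
    moreover have "(\<Sum>v\<in>active d \<gamma>. f v x) = (\<Sum>v\<in>active d \<gamma>. if v = w then T_op (shifted_kernel c') D w (\<lambda>_. 1) x else 0)"
      using x by (intro sum.cong refl) (auto simp: f_def)
    moreover have "\<dots> = T_op (shifted_kernel c') D w (\<lambda>_. 1) x"
      using w finite_active by simp
    moreover have "(\<Sum>v\<in>active d \<gamma>. f' v x) = (\<Sum>v\<in>active d \<gamma>. T_op (shifted_kernel c) D v (h v) x)"
      using x f'h by (intro sum.cong refl) simp
    ultimately show ?thesis by simp
  qed
  have "(\<integral>x. J x * T_op (shifted_kernel c') D w (\<lambda>_. 1) x \<partial>Q)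
      = (\<integral>x. (\<Sum>v\<in>active d \<gamma>. J x * T_op (shifted_kernel c) D v (h v) x) \<partial>Q)"
    by (rule Bochner_Integration.integral_cong[OF refl]) (simp add: space_Q T_eq sum_distrib_left)
  also have "\<dots> = (\<Sum>v\<in>active d \<gamma>. \<integral>x. J x * T_op (shifted_kernel c) D v (h v) x \<partial>Q)"
    unfolding J_def Q_def
    using component_functional_integrable[OF c(2,1,1) a u' fin(2) h]
    by (intro Bochner_Integration.integral_sum) auto
  also have "\<dots> = 0"
  proof (rule sum.neutral, rule ballI)
    fix v assume v: "v \<in> active d \<gamma>"
    \<comment> \<open>Being inactive, u differs from the active set v. A coordinate in u but not in
      v is killed by \<delta>_a - \<delta>_0, one in v but not in u by the zero \<mu>-mean of the
      kernel for c.\<close>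
    obtain i where i: "i \<in> {1..d}" "i \<in> u \<longleftrightarrow> i \<notin> v"
    proof -
      have "u \<noteq> v" using u(2) v by blast
      then obtain i where "i \<in> u \<longleftrightarrow> i \<notin> v" by blast
      moreover from this have "i \<in> {1..d}" using u' fin(2)[OF v] by blast
      ultimately show ?thesis using that by blast
    qed
    have "(\<integral>x. J x * T_op (shifted_kernel c) D v (h v) x \<partial>Q)
        = (\<integral>t. h v t * (\<Prod>j\<in>{1..d}. component_factor (\<lambda>t. c t - c t) a u v j (t j)) \<partial>leb_pow v D)"
      unfolding J_def Q_def using component_functional_eq[OF c(2,1,1) a u' fin(2)[OF v] h[OF v]] .
    moreover have "(\<Prod>j\<in>{1..d}. component_factor (\<lambda>t. c t - c t) a u v j (t j)) = 0" for t
      using i by (intro prod_zero bexI[of _ i]) (auto simp: component_factor_def)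
    ultimately show "(\<integral>x. J x * T_op (shifted_kernel c) D v (h v) x \<partial>Q) = 0"
      by (simp only: mult_zero_right Bochner_Integration.integral_zero)
  qed
  \<comment> \<open>The same functional is now evaluated on the test function through the kernel for
    c'.\<close>
  finally have "(\<integral>t. 1 * (\<Prod>j\<in>{1..d}. component_factor (\<lambda>t. c t - c' t) a u w j (t j)) \<partial>leb_pow w D) = 0"
    unfolding J_def Q_def
      component_functional_eq[OF c(2,1) c' a u' w(1) one_in_Lp_psi[OF fin(1)[OF w(2)]]] .
  moreover have "(\<Prod>j\<in>{1..d}. component_factor (\<lambda>t. c t - c' t) a u w j (t j)) = (\<Prod>j\<in>w. k j (t j))" for t
    using w(1) u(1) by (intro prod.mono_neutral_cong_right) (auto simp: component_factor_def k_def)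
  ultimately have "(\<integral>t. (\<Prod>j\<in>w. k j (t j)) \<partial>leb_pow w D) = 0"
    by simp
  moreover have "integrable (lebesgue_on D) (k j)" for j
    using dual_integrable[OF dual_indicator[OF a(1)]] dual_integrable[OF diff_dual[OF c(1) c']]
    by (cases "j \<in> u") (simp_all add: k_def[abs_def])
  ultimately have "(\<Prod>j\<in>w. \<integral>s. k j s \<partial>lebesgue_on D) = 0"
    using product_integral_prod[OF fin(1)[OF w(2)], of k] by simp
  then obtain j where "(\<integral>s. k j s \<partial>lebesgue_on D) = 0"
    using fin(1)[OF w(2)] by (auto simp: prod_zero_iff)
  \<comment> \<open>By \<open>ne\<close> the vanishing factor must have its index in u, but there
    the integral is half the length of [0,a).\<close>
  with ne have "(\<integral>s. indicator {0..<a} s / 2 \<partial>lebesgue_on D) = (0::real)"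
    by (cases "j \<in> u") (simp_all add: k_def)
  then have "(\<integral>s. indicator {0..<a} s \<partial>lebesgue_on D) = (0::real)" by simp
  then have "AE s in lebesgue_on D. indicator {0..<a} s = (0::real)"
    using dual_integrable[OF dual_indicator[OF a(1)]] 
    by (subst (asm) integral_nonneg_eq_0_iff_AE) auto
  then have "AE s in lebesgue_on D. \<not> s \<in> {0<..<a}"
    by eventually_elim (auto simp: indicator_def split: if_splits)
  then show False by (rule AE_lebesgue_on_interval_False[OF a(1) order_refl a(2)])
qed

end

section \<open>From the integrability condition to dual functions\<close>

text \<open>Extension by zero turns the local condition on [0,x) into a statement on D.\<close>

lemma Lp_indicator_mult:
  assumes S: "S \<in> sets lebesgue" "S \<subseteq> D" and D: "D \<in> sets lebesgue"
    and f: "f \<in> Lp q (lebesgue_on S)" "f \<in> borel_measurable (lebesgue_on D)"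
  shows "(\<lambda>t. indicator S t * f t) \<in> Lp q (lebesgue_on D)"
proof -
  have restr: "lebesgue_on S = restrict_space (lebesgue_on D) S"
    using S D by (subst restrict_restrict_space) (auto simp: inf.absorb2)
  have S': "S \<in> sets (lebesgue_on D)" using S D by (auto simp: sets_restrict_space_iff)
  have S_Int: "S \<inter> space (lebesgue_on D) \<in> sets (lebesgue_on D)" using S S' by (simp add: inf.absorb1)
  have meas: "(\<lambda>t. indicator S t * f t) \<in> borel_measurable (lebesgue_on D)"
    using f(2) S' by (intro borel_measurable_times borel_measurable_indicator) auto
  show ?thesis
  proof (cases "q = \<top>")
    case True
    then obtain C where "AE t in lebesgue_on S. \<bar>f t\<bar> \<le> C"
      using f(1) by (auto simp: weighted_Lp_infinity_iff)
    then have "AE t in lebesgue_on D. t \<in> S \<longrightarrow> \<bar>f t\<bar> \<le> C"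
      unfolding restr by (subst (asm) AE_restrict_space_iff[OF S_Int])
    then have "AE t in lebesgue_on D. \<bar>indicator S t * f t\<bar> \<le> max 0 C"
      by eventually_elim (auto simp: indicator_def)
    with meas True show ?thesis by (auto simp: weighted_Lp_infinity_iff)
  next
    case False
    then have q: "q < \<infinity>" by (simp add: less_top)
    have "(\<integral>\<^sup>+ t. ennreal (\<bar>indicator S t * f t\<bar> powr enn2real q * 1) \<partial>lebesgue_on D)
        = (\<integral>\<^sup>+ t. ennreal (\<bar>f t\<bar> powr enn2real q * 1) * indicator S t \<partial>lebesgue_on D)"
      by (intro nn_integral_cong) (auto simp: indicator_def)
    also have "\<dots> = (\<integral>\<^sup>+ t. ennreal (\<bar>f t\<bar> powr enn2real q * 1) \<partial>lebesgue_on S)"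
      unfolding restr by (rule nn_integral_restrict_space[OF S_Int, symmetric])
    also have "\<dots> < \<infinity>" using f(1) q by (simp add: weighted_Lp_finite_iff)
    finally show ?thesis using meas q by (simp add: weighted_Lp_finite_iff)
  qed
qed

text \<open>The exponent \<open>- 1 / enn2real \<top>\<close> is 0, so the weight factor takes only
  the values 0 and 1.\<close>

lemma Lp_1_imp_dual_weighted_top:
  assumes b: "b \<in> Lp 1 M" and [measurable]: "w \<in> borel_measurable M"
  shows "b \<in> dual_weighted \<top> 1 M w"
proof -
  note [measurable] = weighted_Lp_measurable[OF b]
  have "(\<lambda>t. b t * w t powr (- 1 / enn2real \<top>)) \<in> Lp 1 M"
    by (rule weighted_Lp_dominated[OF b]) (auto simp: abs_mult)
  with b show ?thesis by (simp add: dual_weighted_def weighted_Lp_measurable)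
qed

lemma weighted_interval_ex:
  assumes adm: "admissible_interval T D" and dens: "positive_density D \<psi>"
    and cond: "integrability_condition D p \<psi>"
  shows "\<exists>q. weighted_interval D p q \<psi>"
proof -
  have T: "0 < T" and D: "D = {x. 0 \<le> x \<and> ereal x < T} \<or> T < \<infinity> \<and> D = {x. 0 \<le> x \<and> ereal x \<le> T}"
    using adm by (auto simp: admissible_interval_def)
  have "{x \<in> space borel. 0 \<le> x \<and> ereal x < T} \<in> sets borel" by measurable
  moreover have "{x \<in> space borel. 0 \<le> x \<and> ereal x \<le> T} \<in> sets borel" by measurable
  ultimately have "D \<in> sets borel" using D by auto
  then have D_leb: "D \<in> sets lebesgue" by simp
  have zero: "0 \<in> D" using D T by (auto simp: zero_ereal_def[symmetric])
  have nonneg: "0 \<le> x" if "x \<in> D" for x using D that by auto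
  have down: "y \<in> D" if "x \<in> D" "0 \<le> y" "y \<le> x" for x y
  proof -
    have "ereal y \<le> ereal x" using that by simp
    then show ?thesis using D that
      by (auto intro: order_le_less_trans[of "ereal y" "ereal x"] order_trans[of "ereal y" "ereal x"])
  qed
  \<comment> \<open>Any real strictly between 0 and T lies in D for both forms of the
    interval.\<close>
  obtain a where "0 < ereal a" "ereal a < T" using T ereal_dense2[of 0 T] by auto
  then have pos: "\<exists>a\<in>D. 0 < a" using D by (intro bexI[of _ a]) auto
  have psi: "\<psi> \<in> borel_measurable (lebesgue_on D)" using dens by (simp add: positive_density_def)
  have sub: "{0..<x} \<subseteq> D" if "x \<in> D" for x using down[OF that] by auto
  have ind: "indicator {0..<x} \<in> borel_measurable (lebesgue_on D)" if "x \<in> D" for x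
    using sub[OF that] D_leb by (intro borel_measurable_indicator) (simp add: sets_restrict_space_iff)
  have key: ?thesis if q: "1 / p + 1 / q = 1"
    and d: "\<And>x. x \<in> D \<Longrightarrow> indicator {0..<x} \<in> dual_weighted p q (lebesgue_on D) \<psi>"
    "tail D \<psi> \<in> dual_weighted p q (lebesgue_on D) \<psi>" for q
    by (rule exI[of _ q], rule weighted_interval.intro) (fact D_leb zero pos nonneg down dens q d)+
  show ?thesis
  proof (cases "p = \<top>")
    case True
    then have "tail D \<psi> \<in> Lp 1 (lebesgue_on D)" using cond by (simp add: integrability_condition_def)
    then have "tail D \<psi> \<in> dual_weighted p 1 (lebesgue_on D) \<psi>"
      using psi True by (simp add: Lp_1_imp_dual_weighted_top)
    moreover have "indicator {0..<x} \<in> dual_weighted p 1 (lebesgue_on D) \<psi>" if x: "x \<in> D" for x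
    proof -
      \<comment> \<open>For p = \<top> the finite length of [0,x) gives integrability of its
        indicator.\<close>
      have "(\<lambda>_. 1) \<in> Lp 1 (lebesgue_on {0..<x})"
        using nonneg[OF x] by (simp add: weighted_Lp_finite_iff emeasure_restrict_space)
      then have "(\<lambda>t. indicator {0..<x} t * 1) \<in> Lp 1 (lebesgue_on D)"
        using sub[OF x] D_leb by (intro Lp_indicator_mult) auto
      then show ?thesis using psi True Lp_1_imp_dual_weighted_top by simp
    qed
    ultimately show ?thesis using True by (intro key[of 1]) auto
  next
    case False
    then obtain q where q: "1 / p + 1 / q = 1"
      and loc: "(\<lambda>t. \<psi> t powr (- 1 / enn2real p)) \<in> Lp_loc q D"
      and tail: "(\<lambda>t. tail D \<psi> t * \<psi> t powr (- 1 / enn2real p)) \<in> Lp q (lebesgue_on D)"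
      using cond by (auto simp: integrability_condition_def)
    have "indicator {0..<x} \<in> dual_weighted p q (lebesgue_on D) \<psi>" if x: "x \<in> D" for x
      unfolding dual_weighted_def
      using ind[OF x] loc psi sub[OF x] D_leb x
      by (auto simp: Lp_loc_def intro!: Lp_indicator_mult)
    moreover have "tail D \<psi> \<in> dual_weighted p q (lebesgue_on D) \<psi>"
      using tail tail_measurable[OF D_leb dens] by (simp add: dual_weighted_def)
    ultimately show ?thesis using q by (intro key)
  qed
qed

section \<open>Comparison of the anchored and the ANOVA space\<close>

theorem proposition13:
  fixes d :: nat and T :: ereal and D :: "real set" and \<psi> :: "real \<Rightarrow> real"
    and p q :: ennreal and \<gamma> :: "nat set \<Rightarrow> real"
  assumes "d \<ge> 1"
    and "admissible_interval T D"
    and "positive_density D \<psi>"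
    and "1 \<le> p" and "1 \<le> q"
    and "integrability_condition D p \<psi>"
    and "\<forall>u. u \<subseteq> {1..d} \<longrightarrow> 0 \<le> \<gamma> u"
    and "\<exists>u. u \<subseteq> {1..d} \<and> \<gamma> u \<noteq> 0"
  shows "(W_space K_anchored d D p q \<psi> \<gamma> = W_space (K_ANOVA D \<psi>) d D p q \<psi> \<gamma> \<longleftrightarrow>
            downward_closed_weights d \<gamma>) \<and>
         (\<not> downward_closed_weights d \<gamma> \<longrightarrow>
            \<not> W_space K_anchored d D p q \<psi> \<gamma> \<subseteq> W_space (K_ANOVA D \<psi>) d D p q \<psi> \<gamma> \<and>
            \<not> W_space (K_ANOVA D \<psi>) d D p q \<psi> \<gamma> \<subseteq> W_space K_anchored d D p q \<psi> \<gamma>)"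
proof -
  obtain p' where "weighted_interval D p p' \<psi>"
    using weighted_interval_ex assms by blast
  then interpret weighted_interval D p p' \<psi> .
  have K: "K_anchored = shifted_kernel (\<lambda>_. 0)" "K_ANOVA D \<psi> = shifted_kernel (tail D \<psi>)"
    by (simp_all add: fun_eq_iff K_anchored_def K_ANOVA_def shifted_kernel_def)
  have "W_space K_anchored d D p q \<psi> \<gamma> = W_space (K_ANOVA D \<psi>) d D p q \<psi> \<gamma>"
    if "downward_closed_weights d \<gamma>"
    unfolding K using that tail_bounded_zero tail_bounded_tail by (intro subset_antisym W_space_subset)
  \<comment> \<open>The functional built from the measure with density \<psi> annihilates the ANOVA
    space; here the integral of c - c' is that of the tail.\<close>
  moreover have "\<not> W_space K_anchored d D p q \<psi> \<gamma> \<subseteq> W_space (K_ANOVA D \<psi>) d D p q \<psi> \<gamma>"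
    if "\<not> downward_closed_weights d \<gamma>"
    unfolding K using integral_tail_pos
    by (intro W_space_not_subset[OF that tail_bounded_tail tail_of_tail tail_bounded_zero]) simp
  \<comment> \<open>With the point mass at 0 the anchored space is annihilated; the integral of c -
    c' changes sign but stays nonzero.\<close>
  moreover have "\<not> W_space (K_ANOVA D \<psi>) d D p q \<psi> \<gamma> \<subseteq> W_space K_anchored d D p q \<psi> \<gamma>"
    if "\<not> downward_closed_weights d \<gamma>"
    unfolding K using integral_tail_pos
    by (intro W_space_not_subset[OF that tail_bounded_zero tail_of_zero tail_bounded_tail]) simp
  ultimately show ?thesis by blast
qed

end
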